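(* Let $G$ be a group with a finite generating set $A$ closed under inversion. Suppose that $G$ has a synchronously regular convergent prefix-rewriting system $R\subseteq A^*\times A^*$ over the alphabet $A$ which is weight non-increasing for some weight function $wt:A\to\mathbb{R}^+$. Then $G$ has an autostackable structure over $A$ with the same normal forms as $R$; that is, there exist a spanning tree $T$ of the Cayley graph $\Gamma_{G,A}$ and a regular bounded flow function $\Phi$ for $(G,A,T)$ such that the set of labels of the non-backtracking paths in $T$ starting at $1_G$ equals the set of words in $A^*$ that are irreducible with respect to $R$.
   Context: $A^*$ is the set of words over $A$; $|u|$ is the length of a word $u$. $A$ is closed under inversion: each $a\in A$ has an inverse letter $a^{-1}\in A$ representing the inverse group element. Synchronous regularity: given $L\subseteq A_1^*\times\cdots\times A_n^*$ and padding symbols $\$_i\notin A_i$, each tuple $(w_1,\dots,w_n)\in L$ is padded by appending symbols $\$_i$ at the end of $w_i$ until all components have length $\max_i|w_i|$; the result is regarded as a word over $\prod_i(A_i\cup\{\$_i\})$. $L$ is synchronously regular if the set of padded tuples is a regular language. Convergent prefix-rewriting system (CP-RS) for $G$ over $A$: a set $R\subseteq A^*\times A^*$ such that $G$ is presented as a monoid by $\mathrm{Mon}\langle A\mid \{u=v : (u,v)\in R\}\rangle$, and the rewritings $uw\to_R vw$ (for $(u,v)\in R$, $w\in A^*$) satisfy: (termination) there is no infinite chain $w_1\to_R w_2\to_R\cdots$; (normal forms) each element of $G$ is represented by exactly one irreducible word (a word that cannot be rewritten). The irreducible words are the normal forms of $R$. $R$ is synchronously regular if it is a synchronously regular language. Weights: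 given $wt:A\to\mathbb{R}^+$, set $wt(a_1\cdots a_n)=\sum_i wt(a_i)$. $R$ is weight non-increasing if $wt(v)\le wt(u)$ for every $(u,v)\in R$. Flow functions: $\Gamma_{G,A}$ is the Cayley graph, with a directed edge $e_{y,a}$ from $y$ to $ya$ labeled $a$ for each $y\in G$, $a\in A$; $e_{y,a}$ and $e_{ya,a^{-1}}$ have the same underlying undirected edge. For an edge $e$, $\iota(e)$ is its initial vertex. For a spanning tree $T$ and a vertex $g$, $\mathrm{nf}(g)$ is the label of the unique non-backtracking path in $T$ from $1_G$ to $g$. A regular bounded flow function for $(G,A,T)$ is a function $\Phi$ from the set of directed edges of $\Gamma_{G,A}$ to the set of directed paths in $\Gamma_{G,A}$ such that: (1) $\Phi(e)$ has the same initial and terminal vertices as $e$; (2) there is a constant $k\ge 0$ such that every $\Phi(e)$ has length at most $k$; (3) if the undirected edge underlying $e$ lies in $T$, then $\Phi(e)=e$; (4) there is no infinite sequence of edges $e_1,e_2,\dots$, all lying outside $T$, with $e_{i+1}$ in the path $\Phi(e_i)$ for all $i$; (5) the set of triples $(\mathrm{nf}(\iota(e)),\mathrm{label}(e),\mathrm{label}(\Phi(e)))$, over all directed edges $e$, is synchronously regular. An autostackable structure for $G$ over $A$ is a spanning tree $T$ together with such a $\Phi$; its normal forms are the words $\mathrm{nf}(g)$, $g\in G$. *)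

theory Defs
  imports "HOL-Algebra.Generated_Groups" "Graph_Theory.Graph_Theory"
begin

section \<open>Regular and synchronously regular languages\<close>

text \<open>A finite automaton can be renumbered, so taking states in \<^typ>\<open>nat\<close> is no restriction.\<close>

definition regular_language :: "'b set \<Rightarrow> 'b list set \<Rightarrow> bool" where
  "regular_language \<Sigma> L \<longleftrightarrow> finite \<Sigma> \<and>
     (\<exists>(Q :: nat set) q\<^sub>0 F \<delta>. finite Q \<and> q\<^sub>0 \<in> Q \<and> F \<subseteq> Q \<and> (\<forall>q\<in>Q. \<forall>x\<in>\<Sigma>. \<delta> q x \<in> Q) \<and>
        L = {w \<in> lists \<Sigma>. foldl \<delta> q\<^sub>0 w \<in> F})"

text \<open>
  A tuple of words is a list of words, one for each alphabet in the list \<open>As\<close>.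
  The padding symbol is \<^const>\<open>None\<close>, and a letter \<open>a\<close> becomes \<open>Some a\<close>.
\<close>

definition pad :: "nat \<Rightarrow> 'a list \<Rightarrow> 'a option list" where
  "pad m w = map Some w @ replicate (m - length w) None"

definition pad_tuple :: "'a list list \<Rightarrow> 'a option list list" where
  "pad_tuple ws =
     (let m = Max (length ` set ws) in map (\<lambda>j. map (\<lambda>w. pad m w ! j) ws) [0..<m])"

definition sync_regular :: "'a set list \<Rightarrow> 'a list list set \<Rightarrow> bool" where
  "sync_regular As L \<longleftrightarrow> L \<subseteq> listset (map lists As) \<and>
     regular_language (listset (map (\<lambda>A. insert None (Some ` A)) As)) (pad_tuple ` L)"


section \<open>Convergent prefix-rewriting systems\<close>

definition word_val :: "('a, 'm) monoid_scheme \<Rightarrow> 'a list \<Rightarrow> 'a" where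
  "word_val G w = foldr (\<lambda>a x. a \<otimes>\<^bsub>G\<^esub> x) w \<one>\<^bsub>G\<^esub>"

inductive_set mon_cong :: "'a set \<Rightarrow> ('a list \<times> 'a list) set \<Rightarrow> ('a list \<times> 'a list) set"
  for A :: "'a set" and R :: "('a list \<times> 'a list) set" where
  refl: "u \<in> lists A \<Longrightarrow> (u, u) \<in> mon_cong A R"
| sym: "(u, v) \<in> mon_cong A R \<Longrightarrow> (v, u) \<in> mon_cong A R"
| trans: "(u, v) \<in> mon_cong A R \<Longrightarrow> (v, w) \<in> mon_cong A R \<Longrightarrow> (u, w) \<in> mon_cong A R"
| rel: "(u, v) \<in> R \<Longrightarrow> x \<in> lists A \<Longrightarrow> y \<in> lists A \<Longrightarrow>
    (x @ u @ y, x @ v @ y) \<in> mon_cong A R"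

definition presented_monoid :: "'a set \<Rightarrow> ('a list \<times> 'a list) set \<Rightarrow> 'a list set monoid" where
  "presented_monoid A R =
     \<lparr> carrier = lists A // mon_cong A R,
       monoid.mult = (\<lambda>X Y. \<Union>x\<in>X. \<Union>y\<in>Y. mon_cong A R `` {x @ y}),
       one = mon_cong A R `` {[]} \<rparr>"

text \<open>The isomorphism is required to send the class of each letter to the element it denotes.\<close>

definition monoid_presentation ::
    "('a, 'm) monoid_scheme \<Rightarrow> 'a set \<Rightarrow> ('a list \<times> 'a list) set \<Rightarrow> bool" where
  "monoid_presentation G A R \<longleftrightarrow>
     (\<exists>\<phi> \<in> iso (presented_monoid A R) G. \<forall>a\<in>A. \<phi> (mon_cong A R `` {[a]}) = a)"

definition prefix_step :: "'a set \<Rightarrow> ('a list \<times> 'a list) set \<Rightarrow> ('a list \<times> 'a list) set" where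
  "prefix_step A R = {(u @ w, v @ w) | u v w. (u, v) \<in> R \<and> w \<in> lists A}"

definition irreducible_words :: "'a set \<Rightarrow> ('a list \<times> 'a list) set \<Rightarrow> 'a list set" where
  "irreducible_words A R = {w \<in> lists A. \<nexists>w'. (w, w') \<in> prefix_step A R}"

definition convergent_prs ::
    "('a, 'm) monoid_scheme \<Rightarrow> 'a set \<Rightarrow> ('a list \<times> 'a list) set \<Rightarrow> bool" where
  "convergent_prs G A R \<longleftrightarrow>
     R \<subseteq> lists A \<times> lists A \<and>
     monoid_presentation G A R \<and>
     (\<nexists>f :: nat \<Rightarrow> 'a list. \<forall>i. (f i, f (Suc i)) \<in> prefix_step A R) \<and>
     (\<forall>g \<in> carrier G. \<exists>!w. w \<in> irreducible_words A R \<and> word_val G w = g)"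

definition sync_regular_prs :: "'a set \<Rightarrow> ('a list \<times> 'a list) set \<Rightarrow> bool" where
  "sync_regular_prs A R \<longleftrightarrow> sync_regular [A, A] {[u, v] | u v. (u, v) \<in> R}"

definition word_weight :: "('a \<Rightarrow> real) \<Rightarrow> 'a list \<Rightarrow> real" where
  "word_weight wt w = sum_list (map wt w)"

definition weight_nonincreasing :: "('a \<Rightarrow> real) \<Rightarrow> ('a list \<times> 'a list) set \<Rightarrow> bool" where
  "weight_nonincreasing wt R \<longleftrightarrow> (\<forall>(u, v) \<in> R. word_weight wt v \<le> word_weight wt u)"


section \<open>Cayley graphs and spanning trees\<close>

text \<open>The directed edge from \<open>y\<close> to \<open>ya\<close> labeled \<open>a\<close> is the pair \<open>(y, a)\<close>.\<close>

definition cayley_graph :: "('a, 'm) monoid_scheme \<Rightarrow> 'a set \<Rightarrow> ('a, 'a \<times> 'a) pre_digraph" where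
  "cayley_graph G A =
     \<lparr> verts = carrier G, arcs = carrier G \<times> A, tail = fst, head = (\<lambda>(y, a). y \<otimes>\<^bsub>G\<^esub> a) \<rparr>"

definition rev_edge :: "('a, 'm) monoid_scheme \<Rightarrow> 'a \<times> 'a \<Rightarrow> 'a \<times> 'a" where
  "rev_edge G e = (fst e \<otimes>\<^bsub>G\<^esub> snd e, inv\<^bsub>G\<^esub> (snd e))"

definition path_label :: "('a \<times> 'a) list \<Rightarrow> 'a list" where
  "path_label p = map snd p"

definition non_backtracking :: "('a, 'm) monoid_scheme \<Rightarrow> ('a \<times> 'a) list \<Rightarrow> bool" where
  "non_backtracking G p \<longleftrightarrow> (\<forall>i. Suc i < length p \<longrightarrow> p ! Suc i \<noteq> rev_edge G (p ! i))"

text \<open>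
  An undirected subgraph is a subgraph whose set of directed edges is closed under reversal.
  Hence \<^const>\<open>strongly_connected\<close> expresses connectedness of the undirected graph. As
  \<^const>\<open>pre_digraph.cycle\<close> admits the cycle running along an edge and back,
  acyclicity only excludes the non-backtracking cycles.
\<close>

definition cayley_spanning_tree ::
    "('a, 'm) monoid_scheme \<Rightarrow> 'a set \<Rightarrow> ('a, 'a \<times> 'a) pre_digraph \<Rightarrow> bool" where
  "cayley_spanning_tree G A T \<longleftrightarrow>
     spanning T (cayley_graph G A) \<and>
     (\<forall>e \<in> arcs T. rev_edge G e \<in> arcs T) \<and>
     strongly_connected T \<and>
     (\<nexists>p. pre_digraph.cycle T p \<and> non_backtracking G p)"

definition tree_path ::
    "('a, 'm) monoid_scheme \<Rightarrow> ('a, 'a \<times> 'a) pre_digraph \<Rightarrow> 'a \<Rightarrow> ('a \<times> 'a) list \<Rightarrow> bool" where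
  "tree_path G T g p \<longleftrightarrow> pre_digraph.awalk T \<one>\<^bsub>G\<^esub> p g \<and> non_backtracking G p"

definition tree_nf ::
    "('a, 'm) monoid_scheme \<Rightarrow> ('a, 'a \<times> 'a) pre_digraph \<Rightarrow> 'a \<Rightarrow> 'a list" where
  "tree_nf G T g = path_label (THE p. tree_path G T g p)"


section \<open>Flow functions\<close>

definition regular_bounded_flow ::
    "('a, 'm) monoid_scheme \<Rightarrow> 'a set \<Rightarrow> ('a, 'a \<times> 'a) pre_digraph \<Rightarrow>
     ('a \<times> 'a \<Rightarrow> ('a \<times> 'a) list) \<Rightarrow> bool" where
  "regular_bounded_flow G A T \<Phi> \<longleftrightarrow>
     (let \<Gamma> = cayley_graph G A in
       (\<forall>e \<in> arcs \<Gamma>. pre_digraph.awalk \<Gamma> (tail \<Gamma> e) (\<Phi> e) (head \<Gamma> e)) \<and>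
       (\<exists>k :: nat. \<forall>e \<in> arcs \<Gamma>. length (\<Phi> e) \<le> k) \<and>
       (\<forall>e \<in> arcs T. \<Phi> e = [e]) \<and>
       (\<nexists>f :: nat \<Rightarrow> 'a \<times> 'a.
          \<forall>i. f i \<in> arcs \<Gamma> - arcs T \<and> f (Suc i) \<in> set (\<Phi> (f i))) \<and>
       sync_regular [A, A, A]
         {[tree_nf G T (tail \<Gamma> e), [snd e], path_label (\<Phi> e)] | e. e \<in> arcs \<Gamma>})"

end

theory Submission
  imports Defs
begin

text \<open>
  As \<open>R\<close> does not increase weights, its normal forms are geodesics for the weighted word metric, and
  as it is synchronously regular, the two sides of a rule fellow-travel. Take the tree spanned by
  the normal forms. For an edge \<open>(g, a)\<close> outside it, with \<open>w\<close> the normal form of \<open>g\<close>, there is a rule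
  \<open>(w a, v)\<close>, but the path from \<open>g\<close> back to the identity and along \<open>v\<close> has unbounded length. The flow
  instead backs up along the last \<open>k\<close> letters of \<open>w\<close> only, crosses to the corresponding vertex of
  \<open>v\<close>, and follows the remainder of \<open>v\<close>. If \<open>k\<close> is large compared with the fellow-traveller
  constant, then the crossing stays strictly closer to the identity than \<open>g\<close>; along the remainder
  the weight does not increase, and there termination is inherited from \<open>R\<close>.
\<close>

section \<open>Left quotients and regular languages\<close>

text \<open>The flow has to terminate and yet be readable by a finite automaton. A rule chosen
  freely for each \<open>w\<close> and \<open>a\<close> would serve termination but not recognition.
  So the choice of \<open>t\<close> sees only the last \<open>k\<close> letters \<open>s\<close> of
  \<open>w\<close> and the set \<open>tails x\<close> of what may still follow \<open>x\<close> in a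
  rule, and there are finitely many such sets. The crossing needs no further choice: its value is
  \<open>val (s @ [a])\<close> times the inverse of \<open>val t\<close>, although it joins vertices
  reached along prefixes of unbounded length. The condition \<open>K + wmax < real k * wmin\<close>
  compares costs: an edge of the crossing starts within \<open>K\<close> of \<open>val x\<close> and
  weighs at most \<open>wmax\<close>, whereas backing up \<open>k\<close> letters gains at least
  \<open>k * wmin\<close>. If \<open>w\<close> is too short for that, backing up ends at the
  identity and nothing has to be crossed. Regularity is proved by counting left quotients
  (Myhill-Nerode): it suffices to find a finite invariant of a prefix that determines its
  quotient.\<close>

definition lquot :: "'b list set \<Rightarrow> 'b list \<Rightarrow> 'b list set" where
  "lquot L x = {y. x @ y \<in> L}"

definition finite_quots :: "'b set \<Rightarrow> 'b list set \<Rightarrow> bool" where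
  "finite_quots \<Sigma> L \<longleftrightarrow> L \<subseteq> lists \<Sigma> \<and> finite (lquot L ` lists \<Sigma>)"

text \<open>The device behind most finiteness proofs below: \<open>f\<close> is an invariant of a
  prefix with finitely many values, and \<open>g\<close> is a quotient that it determines.\<close>

lemma finite_image_factor:
  assumes "finite (f ` S)" and "\<And>x y. x \<in> S \<Longrightarrow> y \<in> S \<Longrightarrow> f x = f y \<Longrightarrow> g x = g y"
  shows "finite (g ` S)"
proof -
  have "g x = g (inv_into S f (f x))" if "x \<in> S" for x
    using that assms(2)[of x "inv_into S f (f x)"] by (simp add: f_inv_into_f inv_into_into)
  then have "g ` S = (\<lambda>z. g (inv_into S f z)) ` f ` S"
    unfolding image_image by (rule image_cong[OF HOL.refl])
  then show ?thesis using assms(1) by simp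
qed

text \<open>The quotients serve as states, numbered by \<open>to_nat_on\<close> because states are
  natural numbers; \<open>\<delta>\<close> decodes a number, takes the derivative by a letter and
  encodes again.\<close>

lemma regular_language_if_finite_quots:
  assumes "finite \<Sigma>" and "finite_quots \<Sigma> L"
  shows "regular_language \<Sigma> L"
proof -
  define U where "U = lquot L ` lists \<Sigma>"
  have fin: "finite U" and sub: "L \<subseteq> lists \<Sigma>"
    using assms(2) by (auto simp: finite_quots_def U_def)
  define h where "h = to_nat_on U"
  have inj: "inj_on h U"
    unfolding h_def by (rule inj_on_to_nat_on[OF countable_finite[OF fin]])
  define q0 where "q0 = h (lquot L [])"
  define F where "F = h ` {X \<in> U. [] \<in> X}"
  define \<delta> where "\<delta> q x = h {y. x # y \<in> inv_into U h q}" for q x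
  have step: "\<delta> (h (lquot L w)) x = h (lquot L (w @ [x]))" if "w \<in> lists \<Sigma>" for w x
    using that inj by (simp add: \<delta>_def U_def inv_into_f_f) (simp add: lquot_def)
  have run: "foldl \<delta> q0 w = h (lquot L w)" if "w \<in> lists \<Sigma>" for w
    using that by (induction w rule: rev_induct) (auto simp: q0_def step)
  have "L = {w \<in> lists \<Sigma>. foldl \<delta> q0 w \<in> F}"
  proof -
    have "w \<in> L \<longleftrightarrow> h (lquot L w) \<in> F" if w: "w \<in> lists \<Sigma>" for w
    proof -
      have "lquot L w \<in> U" using w by (auto simp: U_def)
      then have "h (lquot L w) \<in> F \<longleftrightarrow> [] \<in> lquot L w"
        using inj by (auto simp: F_def dest: inj_onD)
      then show ?thesis by (simp add: lquot_def)
    qed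
    then have "w \<in> L \<longleftrightarrow> foldl \<delta> q0 w \<in> F" if "w \<in> lists \<Sigma>" for w
      using that run[OF that] by simp
    then show ?thesis using sub by blast
  qed
  moreover have "q0 \<in> h ` U" by (auto simp: q0_def U_def)
  moreover have "F \<subseteq> h ` U" by (auto simp: F_def)
  moreover have "\<forall>q\<in>h ` U. \<forall>x\<in>\<Sigma>. \<delta> q x \<in> h ` U"
    by (auto simp: U_def step)
  ultimately show ?thesis
    unfolding regular_language_def using assms(1) fin
    by (intro conjI exI[of _ "h ` U"] exI[of _ q0] exI[of _ F] exI[of _ \<delta>]) auto
qed

text \<open>Words that lead to the same state have the same quotient.\<close>

lemma finite_quots_if_regular_language:
  assumes "regular_language \<Sigma> L"
  shows "finite_quots \<Sigma> L"
proof -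
  obtain Q :: "nat set" and q0 F \<delta> where Q: "finite Q" "q0 \<in> Q" "\<forall>q\<in>Q. \<forall>x\<in>\<Sigma>. \<delta> q x \<in> Q"
    and L: "L = {w \<in> lists \<Sigma>. foldl \<delta> q0 w \<in> F}"
    using assms by (auto simp: regular_language_def)
  have "foldl \<delta> q0 w \<in> Q" if "w \<in> lists \<Sigma>" for w
    using that by (induction w rule: rev_induct) (use Q in auto)
  then have "finite (foldl \<delta> q0 ` lists \<Sigma>)"
    using Q(1) by (meson finite_subset image_subsetI)
  then have "finite (lquot L ` lists \<Sigma>)"
    by (rule finite_image_factor) (auto simp: L lquot_def)
  then show ?thesis by (auto simp: finite_quots_def L)
qed

lemma finite_quots_Un:
  assumes "finite_quots \<Sigma> L" and "finite_quots \<Sigma> L'"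
  shows "finite_quots \<Sigma> (L \<union> L')"
proof -
  have "lquot (L \<union> L') x = lquot L x \<union> lquot L' x" for x
    by (auto simp: lquot_def)
  then have "lquot (L \<union> L') ` lists \<Sigma> \<subseteq>
      (\<lambda>(X, Y). X \<union> Y) ` ((lquot L ` lists \<Sigma>) \<times> (lquot L' ` lists \<Sigma>))"
    by auto
  moreover have "finite ((\<lambda>(X, Y). X \<union> Y) ` ((lquot L ` lists \<Sigma>) \<times> (lquot L' ` lists \<Sigma>)))"
    using assms by (simp add: finite_quots_def)
  ultimately have "finite (lquot (L \<union> L') ` lists \<Sigma>)" by (rule finite_subset)
  moreover have "L \<union> L' \<subseteq> lists \<Sigma>" using assms by (auto simp: finite_quots_def)
  ultimately show ?thesis by (simp add: finite_quots_def)
qed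

lemma finite_quots_Int:
  assumes "finite_quots \<Sigma> L" and "finite_quots \<Sigma> L'"
  shows "finite_quots \<Sigma> (L \<inter> L')"
proof -
  have "lquot (L \<inter> L') x = lquot L x \<inter> lquot L' x" for x
    by (auto simp: lquot_def)
  then have "lquot (L \<inter> L') ` lists \<Sigma> \<subseteq>
      (\<lambda>(X, Y). X \<inter> Y) ` ((lquot L ` lists \<Sigma>) \<times> (lquot L' ` lists \<Sigma>))"
    by auto
  moreover have "finite ((\<lambda>(X, Y). X \<inter> Y) ` ((lquot L ` lists \<Sigma>) \<times> (lquot L' ` lists \<Sigma>)))"
    using assms by (simp add: finite_quots_def)
  ultimately have "finite (lquot (L \<inter> L') ` lists \<Sigma>)" by (rule finite_subset)
  moreover have "L \<inter> L' \<subseteq> lists \<Sigma>" using assms by (auto simp: finite_quots_def)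
  ultimately show ?thesis by (simp add: finite_quots_def)
qed

lemma finite_quots_UN:
  assumes "finite I" and "\<And>i. i \<in> I \<Longrightarrow> finite_quots \<Sigma> (L i)"
  shows "finite_quots \<Sigma> (\<Union>i\<in>I. L i)"
  using assms
proof (induction I rule: finite_induct)
  case empty
  have "lquot {} ` lists \<Sigma> \<subseteq> {{}}" by (auto simp: lquot_def)
  then show ?case by (auto simp: finite_quots_def intro: finite_subset)
qed (auto intro!: finite_quots_Un)

lemma finite_quots_finite:
  assumes "finite L" and "L \<subseteq> lists \<Sigma>"
  shows "finite_quots \<Sigma> L"
proof -
  define S where "S = (\<Union>w\<in>L. (\<lambda>n. drop n w) ` {..length w})"
  have "lquot L x \<subseteq> S" for x
  proof
    fix y assume "y \<in> lquot L x"
    then have "x @ y \<in> L" by (simp add: lquot_def)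
    moreover have "y = drop (length x) (x @ y)" "length x \<le> length (x @ y)" by auto
    ultimately show "y \<in> S" unfolding S_def by blast
  qed
  moreover have "finite S" using assms(1) by (simp add: S_def)
  ultimately have "finite (lquot L ` lists \<Sigma>)"
    by (meson finite_Pow_iff finite_subset image_subsetI PowI)
  then show ?thesis using assms(2) by (simp add: finite_quots_def)
qed

section \<open>Relettering of words by maps that depend on the position\<close>

primrec encode_from :: "(nat \<Rightarrow> 'a \<Rightarrow> 'b) \<Rightarrow> nat \<Rightarrow> 'a list \<Rightarrow> 'b list" where
  "encode_from F i [] = []"
| "encode_from F i (x # xs) = F i x # encode_from F (Suc i) xs"

lemma encode_from_append:
  "encode_from F i (x @ y) = encode_from F i x @ encode_from F (i + length x) y"
  by (induction x arbitrary: i) auto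

lemma length_encode_from [simp]: "length (encode_from F i x) = length x"
  by (induction x arbitrary: i) auto

lemma encode_from_eq_map:
  "encode_from F i x = map (\<lambda>j. F (i + j) (x ! j)) [0..<length x]"
  by (induction x arbitrary: i) (auto simp: upt_conv_Cons map_Suc_upt[symmetric] simp del: upt_Suc)

lemma encode_from_cong:
  "(\<And>n. F (i + n) = F (j + n)) \<Longrightarrow> encode_from F i x = encode_from F j x"
proof (induction x arbitrary: i j)
  case (Cons a x)
  have "F i = F j" using Cons.prems[of 0] by simp
  moreover have "encode_from F (Suc i) x = encode_from F (Suc j) x"
    using Cons.prems[of "Suc _"] by (intro Cons.IH) simp
  ultimately show ?case by simp
qed simp

lemma encode_from_inj:
  assumes "\<And>n. inj (F n)" and "encode_from F i x = encode_from F i y"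
  shows "x = y"
  using assms(2)
proof (induction x arbitrary: i y)
  case Nil
  then show ?case by (cases y) auto
next
  case (Cons a x)
  then show ?case using assms(1) by (cases y) (auto dest: injD)
qed

text \<open>The quotient at the code of \<open>x\<close> is determined by the quotient of
  \<open>C\<close> at \<open>x\<close> and by \<open>length x\<close>, and the length matters only
  up to \<open>Suc M\<close>: beyond \<open>M\<close> the letter maps agree and the length condition
  holds. Injectivity lets \<open>x\<close> be read off its code.\<close>

lemma finite_quots_encode:
  assumes C: "finite_quots A C"
    and const: "\<And>n. M \<le> n \<Longrightarrow> F n = F M"
    and inj: "\<And>n. inj (F n)"
    and mem: "\<And>n a. a \<in> A \<Longrightarrow> F n a \<in> \<Sigma>"
  shows "finite_quots \<Sigma> (encode_from F 0 ` {w \<in> C. M < length w})"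
    (is "finite_quots \<Sigma> ?L")
proof -
  have lists: "encode_from F i w \<in> lists \<Sigma>" if "w \<in> lists A" for i w
    using that by (induction w arbitrary: i) (auto intro: mem)
  define H where "H x = lquot ?L (encode_from F 0 x)" for x
  have H: "H x = encode_from F (length x) ` {y \<in> lquot C x. M < length x + length y}" for x
  proof (rule Set.set_eqI, rule HOL.iffI)
    fix d assume "d \<in> H x"
    then obtain w where w: "w \<in> C" "M < length w" "encode_from F 0 x @ d = encode_from F 0 w"
      by (auto simp: H_def lquot_def)
    define y where "y = drop (length x) w"
    have len: "length w = length x + length d"
      using arg_cong[OF w(3), of length] by simp
    have split: "encode_from F 0 w = encode_from F 0 (take (length x) w) @ encode_from F (length x) y"
      using encode_from_append[of F 0 "take (length x) w" y] len by (simp add: y_def)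
    have "encode_from F 0 x = encode_from F 0 (take (length x) w)" and d: "d = encode_from F (length x) y"
      using w(3) len unfolding split by (auto simp: append_eq_append_conv)
    then have "x = take (length x) w"
      by (blast intro: encode_from_inj[of F, OF inj])
    then have "w = x @ y" by (metis append_take_drop_id y_def)
    then show "d \<in> encode_from F (length x) ` {y \<in> lquot C x. M < length x + length y}"
      using w d by (auto simp: lquot_def)
  next
    fix d assume "d \<in> encode_from F (length x) ` {y \<in> lquot C x. M < length x + length y}"
    then obtain y where "x @ y \<in> C" "M < length (x @ y)" "d = encode_from F (length x) y"
      by (auto simp: lquot_def)
    then show "d \<in> H x"
      unfolding H_def lquot_def using encode_from_append[of F 0 x y] by (auto intro!: image_eqI)
  qed
  have "finite ((\<lambda>x. (lquot C x, min (length x) (Suc M))) ` lists A)"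
  proof (rule finite_subset)
    show "(\<lambda>x. (lquot C x, min (length x) (Suc M))) ` lists A \<subseteq> lquot C ` lists A \<times> {..Suc M}"
      by auto
    show "finite (lquot C ` lists A \<times> {..Suc M})"
      using C by (simp add: finite_quots_def)
  qed
  then have fin: "finite (H ` lists A)"
  proof (rule finite_image_factor)
    fix x x' :: "'a list"
    assume eq: "(lquot C x, min (length x) (Suc M)) = (lquot C x', min (length x') (Suc M))"
    consider "length x = length x'" | "M < length x" "M < length x'"
      using eq by (auto simp: min_def split: if_splits)
    then show "H x = H x'"
    proof cases
      case 1 then show ?thesis using eq by (simp add: H)
    next
      case 2
      have "F (length x + n) = F (length x' + n)" for n
        using const[of "length x + n"] const[of "length x' + n"] 2 by simp
      then have "encode_from F (length x) y = encode_from F (length x') y" for y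
        by (rule encode_from_cong)
      then show ?thesis using eq 2 by (simp add: H)
    qed
  qed
  \<comment> \<open>A prefix that is not the code of a word over \<open>A\<close> has empty
    quotient.\<close>
  have "lquot ?L c \<in> insert {} (H ` lists A)" for c
  proof (cases "lquot ?L c = {}")
    case False
    then obtain d w where w: "c @ d = encode_from F 0 w" "w \<in> C" by (auto simp: lquot_def)
    have len: "length w = length c + length d"
      using arg_cong[OF w(1), of length] by simp
    have "encode_from F 0 w =
        encode_from F 0 (take (length c) w) @ encode_from F (length c) (drop (length c) w)"
      using encode_from_append[of F 0 "take (length c) w" "drop (length c) w"] len by simp
    then have "c = encode_from F 0 (take (length c) w)"
      using w(1) len by (metis append_eq_append_conv length_encode_from length_take min_absorb2 le_add1)
    moreover have "take (length c) w \<in> lists A"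
      using w(2) C by (auto simp: finite_quots_def dest: in_set_takeD)
    ultimately have "lquot ?L c = H (take (length c) w)" by (simp add: H_def)
    then show ?thesis using \<open>take (length c) w \<in> lists A\<close> by blast
  qed simp
  then have "finite (lquot ?L ` lists \<Sigma>)"
    using fin by (meson finite_insert finite_subset image_subsetI)
  moreover have "?L \<subseteq> lists \<Sigma>"
    using lists C by (auto simp: finite_quots_def)
  ultimately show ?thesis by (simp add: finite_quots_def)
qed

section \<open>Padded tuples\<close>

text \<open>Drops every \<open>None\<close>, not just a trailing block, so that it commutes with
  concatenation and applies to any segment of a padded word.\<close>

definition unpad :: "'a option list \<Rightarrow> 'a list" where
  "unpad os = map the (filter (\<lambda>x. x \<noteq> None) os)"

lemma unpad_append: "unpad (xs @ ys) = unpad xs @ unpad ys"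
  by (simp add: unpad_def)

lemma unpad_pad:
  "unpad (take n (pad m w)) = take n w" "unpad (drop n (pad m w)) = drop n w"
proof -
  have [simp]: "unpad (map Some u) = u" for u :: "'a list" by (induction u) (auto simp: unpad_def)
  have [simp]: "unpad (replicate j None) = []" for j by (auto simp: unpad_def)
  show "unpad (take n (pad m w)) = take n w" "unpad (drop n (pad m w)) = drop n w"
    by (simp_all add: pad_def unpad_append take_map drop_map)
qed

abbreviation component :: "nat \<Rightarrow> 'a option list list \<Rightarrow> 'a list" where
  "component j c \<equiv> unpad (map (\<lambda>col. col ! j) c)"

lemma length_pad: "length w \<le> m \<Longrightarrow> length (pad m w) = m"
  by (simp add: pad_def)

lemma map_nth_pad_tuple:
  assumes "j < length ws"
  shows "map (\<lambda>col. col ! j) (pad_tuple ws) = pad (Max (length ` set ws)) (ws ! j)"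
proof -
  have "length (ws ! j) \<le> Max (length ` set ws)" using assms by auto
  then show ?thesis
    using assms by (auto simp: pad_tuple_def Let_def length_pad intro!: nth_equalityI)
qed

lemma length_pad_tuple: "length (pad_tuple ws) = Max (length ` set ws)"
  by (simp add: pad_tuple_def Let_def)

lemma component_pad_tuple:
  assumes "j < length ws"
  shows "component j (take n (pad_tuple ws)) = take n (ws ! j)"
    and "component j (drop n (pad_tuple ws)) = drop n (ws ! j)"
  using map_nth_pad_tuple[OF assms] by (simp_all add: unpad_pad flip: take_map drop_map)

text \<open>From index \<open>M\<close> on, the rows of \<open>a\<close> and \<open>p\<close> are
  padding. So for \<open>w\<close> longer than \<open>M\<close> the padded triple is a relettering
  of \<open>w\<close> by maps that are constant from \<open>M\<close> on; the other \<open>w\<close>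
  are finitely many.\<close>

lemma finite_quots_pad_tuple_letter_word:
  assumes C: "finite_quots A C" and a: "a \<in> A" and p: "p \<in> lists A" and fin: "finite A"
  shows "finite_quots (listset (map (\<lambda>A. insert None (Some ` A)) [A, A, A]))
    (pad_tuple ` (\<lambda>w. [w, [a], p]) ` C)" (is "finite_quots ?\<Sigma> ?L")
proof -
  define M where "M = max 1 (length p)"
  define F where "F = (\<lambda>j x. [Some x, if j = 0 then Some a else None,
     if j < length p then Some (p ! j) else None])"
  have long: "pad_tuple [w, [a], p] = encode_from F 0 w" if "M < length w" for w
  proof (rule nth_equalityI)
    have max: "Max (length ` set [w, [a], p]) = length w"
      using that by (auto simp: M_def)
    then show "length (pad_tuple [w, [a], p]) = length (encode_from F 0 w)"
      by (simp add: length_pad_tuple)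
    fix j assume "j < length (pad_tuple [w, [a], p])"
    then have "j < length w" using max by (simp add: length_pad_tuple)
    then show "pad_tuple [w, [a], p] ! j = encode_from F 0 w ! j"
      using that max
      by (auto simp: pad_tuple_def Let_def encode_from_eq_map F_def pad_def nth_append M_def)
  qed
  have \<Sigma>: "col \<in> ?\<Sigma> \<longleftrightarrow> (\<exists>x y z. col = [x, y, z] \<and> {x, y, z} \<subseteq> insert None (Some ` A))" for col
    by (auto simp: set_Cons_def)
  have long_quots: "finite_quots ?\<Sigma> (encode_from F 0 ` {w \<in> C. M < length w})"
  proof (rule finite_quots_encode[OF C])
    show "F n = F M" if "M \<le> n" for n using that by (auto simp: F_def M_def)
    show "inj (F n)" for n by (auto simp: F_def inj_def)
    show "F n x \<in> ?\<Sigma>" if "x \<in> A" for n x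
      using that a p unfolding \<Sigma> by (auto simp: F_def dest: nth_mem)
  qed
  have short_quots: "finite_quots ?\<Sigma> (pad_tuple ` (\<lambda>w. [w, [a], p]) ` {w \<in> C. length w \<le> M})"
  proof (rule finite_quots_finite)
    have "{w \<in> C. length w \<le> M} \<subseteq> {w. set w \<subseteq> A \<and> length w \<le> M}"
      using C by (auto simp: finite_quots_def)
    then show "finite (pad_tuple ` (\<lambda>w. [w, [a], p]) ` {w \<in> C. length w \<le> M})"
      using finite_lists_length_le[OF fin] finite_subset by blast
    have pad: "pad m u ! j \<in> insert None (Some ` A)" if "u \<in> lists A" "j < m" for m u j
      using that by (auto simp: pad_def nth_append)
    have "pad_tuple [w, [a], p] \<in> lists ?\<Sigma>" if "w \<in> C" for w
    proof (rule in_listsI, rule ballI)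
      fix col assume "col \<in> set (pad_tuple [w, [a], p])"
      then obtain m j where "j < m" and col: "col = [pad m w ! j, pad m [a] ! j, pad m p ! j]"
        by (auto simp: pad_tuple_def Let_def)
      moreover have "w \<in> lists A" "[a] \<in> lists A"
        using C that a by (auto simp: finite_quots_def)
      ultimately have "{pad m w ! j, pad m [a] ! j, pad m p ! j} \<subseteq> insert None (Some ` A)"
        using pad[OF _ \<open>j < m\<close>] p by (simp only: insert_subset empty_subsetI simp_thms)
      then show "col \<in> ?\<Sigma>" unfolding \<Sigma> using col by blast
    qed
    then show "pad_tuple ` (\<lambda>w. [w, [a], p]) ` {w \<in> C. length w \<le> M} \<subseteq> lists ?\<Sigma>"
      by blast
  qed
  have "?L = encode_from F 0 ` {w \<in> C. M < length w} \<union>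
      pad_tuple ` (\<lambda>w. [w, [a], p]) ` {w \<in> C. length w \<le> M}"
  proof -
    have "encode_from F 0 ` {w \<in> C. M < length w} =
        pad_tuple ` (\<lambda>w. [w, [a], p]) ` {w \<in> C. M < length w}"
      by (auto simp: long image_image)
    moreover have "C = {w \<in> C. M < length w} \<union> {w \<in> C. length w \<le> M}"
      using not_le by blast
    then have "?L = pad_tuple ` (\<lambda>w. [w, [a], p]) ` ({w \<in> C. M < length w} \<union> {w \<in> C. length w \<le> M})"
      by (rule arg_cong)
    ultimately show ?thesis by (simp only: image_Un)
  qed
  then show ?thesis using finite_quots_Un[OF long_quots short_quots] by (simp only:)
qed

section \<open>Normal forms are weighted geodesics\<close>

lemma equiv_mon_cong:
  assumes "R \<subseteq> lists A \<times> lists A"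
  shows "equiv (lists A) (mon_cong A R)"
proof (rule equivI)
  have "(u, v) \<in> mon_cong A R \<Longrightarrow> (u, v) \<in> lists A \<times> lists A" for u v
    by (induction rule: mon_cong.induct) (use assms in auto)
  then show "mon_cong A R \<subseteq> lists A \<times> lists A" by (rule subrelI)
  show "refl_on (lists A) (mon_cong A R)"
    by (rule refl_onI) (rule mon_cong.refl)
  show "sym (mon_cong A R)" by (rule symI) (rule mon_cong.sym)
  show "trans (mon_cong A R)" by (rule transI) (rule mon_cong.trans)
qed

lemma mon_cong_append:
  assumes "(u, v) \<in> mon_cong A R" and "x \<in> lists A" and "y \<in> lists A"
  shows "(x @ u @ y, x @ v @ y) \<in> mon_cong A R"
  using assms
proof (induction rule: mon_cong.induct)
  case (refl u)
  then show ?case by (intro mon_cong.refl) auto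
next
  case (sym u v)
  then show ?case by (auto intro: mon_cong.sym)
next
  case (trans u v w)
  then show ?case by (auto intro: mon_cong.trans)
next
  case (rel u v x' y')
  then have "((x @ x') @ u @ (y' @ y), (x @ x') @ v @ (y' @ y)) \<in> mon_cong A R"
    by (intro mon_cong.rel) auto
  then show ?case by simp
qed

text \<open>The product of classes is a union over all representatives; by congruence all its
  members coincide, and the union is not empty.\<close>

lemma presented_monoid_mult:
  assumes "R \<subseteq> lists A \<times> lists A" and u: "u \<in> lists A" and v: "v \<in> lists A"
  shows "mon_cong A R `` {u} \<otimes>\<^bsub>presented_monoid A R\<^esub> mon_cong A R `` {v} = mon_cong A R `` {u @ v}"
proof -
  note eq = equiv_mon_cong[OF assms(1)]
  have class_eq: "mon_cong A R `` {x @ y} = mon_cong A R `` {u @ v}"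
    if xy: "x \<in> mon_cong A R `` {u}" "y \<in> mon_cong A R `` {v}" for x y
  proof -
    have "y \<in> lists A" using xy eq by (auto simp: equiv_def)
    then have "([] @ u @ y, [] @ x @ y) \<in> mon_cong A R"
      using xy by (intro mon_cong_append) auto
    moreover have "(u @ v @ [], u @ y @ []) \<in> mon_cong A R"
      using xy u by (intro mon_cong_append) auto
    ultimately have "(u @ v, x @ y) \<in> mon_cong A R"
      by (auto intro: mon_cong.trans)
    then show ?thesis by (rule equiv_class_eq[OF eq, symmetric])
  qed
  have nonempty: "mon_cong A R `` {u} \<noteq> {}" "mon_cong A R `` {v} \<noteq> {}"
    using mon_cong.refl[OF u, of R] mon_cong.refl[OF v, of R] by (simp_all add: Image_singleton) metis+
  have "(\<Union>x\<in>mon_cong A R `` {u}. \<Union>y\<in>mon_cong A R `` {v}. mon_cong A R `` {x @ y}) =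
      (\<Union>x\<in>mon_cong A R `` {u}. \<Union>y\<in>mon_cong A R `` {v}. mon_cong A R `` {u @ v})"
    by (intro SUP_cong HOL.refl class_eq)
  also have "\<dots> = mon_cong A R `` {u @ v}" by (simp only: nonempty UN_constant if_False)
  finally have "(\<Union>x\<in>mon_cong A R `` {u}. \<Union>y\<in>mon_cong A R `` {v}. mon_cong A R `` {x @ y}) =
      mon_cong A R `` {u @ v}" .
  then show ?thesis by (simp only: presented_monoid_def monoid.simps)
qed

locale weighted_prs = group G for G (structure) +
  fixes A :: "'a set" and R :: "('a list \<times> 'a list) set" and wt :: "'a \<Rightarrow> real"
  assumes finite_A: "finite A" and A_carrier: "A \<subseteq> carrier G"
    and inv_in_A: "a \<in> A \<Longrightarrow> inv a \<in> A"
    and convergent: "convergent_prs G A R"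
    and sync: "sync_regular_prs A R"
    and wt_pos: "a \<in> A \<Longrightarrow> wt a > 0"
    and noninc: "weight_nonincreasing wt R"
begin

abbreviation val :: "'a list \<Rightarrow> 'a" where "val \<equiv> word_val G"
abbreviation Irr :: "'a list set" where "Irr \<equiv> irreducible_words A R"
abbreviation weight :: "'a list \<Rightarrow> real" where "weight \<equiv> word_weight wt"

lemma A_closed [simp]: "a \<in> A \<Longrightarrow> a \<in> carrier G"
  using A_carrier by blast

lemma val_Nil [simp]: "val [] = \<one>" by (simp add: word_val_def)

lemma val_Cons [simp]: "val (a # w) = a \<otimes> val w" by (simp add: word_val_def)

lemma val_closed [simp]: "w \<in> lists A \<Longrightarrow> val w \<in> carrier G"
  by (induction w) auto

lemma val_append: "u \<in> lists A \<Longrightarrow> v \<in> lists A \<Longrightarrow> val (u @ v) = val u \<otimes> val v"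
  by (induction u) (auto simp: m_assoc)

lemma weight_simps [simp]:
  "weight [] = 0" "weight (a # u) = wt a + weight u" "weight (u @ v) = weight u + weight v"
  by (simp_all add: word_weight_def)

lemma weight_nonneg: "w \<in> lists A \<Longrightarrow> 0 \<le> weight w"
  by (induction w) (auto dest: wt_pos)

lemma R_lists: "(u, v) \<in> R \<Longrightarrow> u \<in> lists A \<and> v \<in> lists A"
  using convergent by (auto simp: convergent_prs_def)

lemma R_weight: "(u, v) \<in> R \<Longrightarrow> weight v \<le> weight u"
  using noninc by (auto simp: weight_nonincreasing_def)

lemma R_val:
  assumes "(u, v) \<in> R"
  shows "val u = val v"
proof -
  have sub: "R \<subseteq> lists A \<times> lists A" using convergent by (simp add: convergent_prs_def)
  let ?cl = "\<lambda>w. mon_cong A R `` {w}"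
  let ?P = "presented_monoid A R"
  obtain \<phi> where hom: "\<phi> \<in> hom ?P G" and letter: "\<And>a. a \<in> A \<Longrightarrow> \<phi> (?cl [a]) = a"
    using convergent by (auto simp: convergent_prs_def monoid_presentation_def iso_def)
  have cl: "?cl w \<in> carrier ?P" if "w \<in> lists A" for w
    using that by (simp add: presented_monoid_def quotientI)
  have mult: "\<phi> (?cl (x @ y)) = \<phi> (?cl x) \<otimes> \<phi> (?cl y)" if "x \<in> lists A" "y \<in> lists A" for x y
    using hom_mult[OF hom cl[OF that(1)] cl[OF that(2)]] presented_monoid_mult[OF sub that] by simp
  have closed: "\<phi> (?cl w) \<in> carrier G" if "w \<in> lists A" for w
    using hom_in_carrier[OF hom cl[OF that]] .
  have "\<phi> (?cl w) = val w" if "w \<in> lists A" for w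
    using that
  proof (induction w)
    case Nil
    \<comment> \<open>\<open>hom\<close> asks only for multiplicativity; the image of the class of
      the empty word is idempotent, hence \<one>.\<close>
    then show ?case using mult[of "[]" "[]"] closed[of "[]"] by (simp add: r_cancel_one)
  next
    case (Cons a w)
    then show ?case using mult[of "[a]" w] letter by auto
  qed
  moreover have "?cl u = ?cl v"
  proof (rule equiv_class_eq[OF equiv_mon_cong[OF sub]])
    show "(u, v) \<in> mon_cong A R"
      using mon_cong.rel[OF assms, of "[]" A "[]"] by simp
  qed
  ultimately show ?thesis using R_lists[OF assms] by metis
qed

section \<open>Normal forms and reduction to them\<close>

definition nf :: "'a \<Rightarrow> 'a list" where
  "nf g = (THE w. w \<in> Irr \<and> val w = g)"

lemma ex1_nf: "g \<in> carrier G \<Longrightarrow> \<exists>!w. w \<in> Irr \<and> val w = g"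
  using convergent by (auto simp: convergent_prs_def)

lemma nf_Irr [simp]: "g \<in> carrier G \<Longrightarrow> nf g \<in> Irr"
  and val_nf [simp]: "g \<in> carrier G \<Longrightarrow> val (nf g) = g"
  using theI'[OF ex1_nf] unfolding nf_def by blast+

lemma Irr_lists: "w \<in> Irr \<Longrightarrow> w \<in> lists A"
  by (simp add: irreducible_words_def)

lemma nf_lists [simp]: "g \<in> carrier G \<Longrightarrow> nf g \<in> lists A"
  by (rule Irr_lists) simp

lemma nf_val: "w \<in> Irr \<Longrightarrow> nf (val w) = w"
  unfolding nf_def using ex1_nf[of "val w"] Irr_lists by (intro the1_equality) auto

lemma nf_eqI: "w \<in> Irr \<Longrightarrow> val w = g \<Longrightarrow> nf g = w"
  using nf_val by blast

lemma prefix_step_append: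
  "(u, v) \<in> prefix_step A R \<Longrightarrow> z \<in> lists A \<Longrightarrow> (u @ z, v @ z) \<in> prefix_step A R"
  unfolding prefix_step_def by fastforce

lemma prefix_step_rtrancl_append:
  assumes "(u, v) \<in> (prefix_step A R)\<^sup>*" and "z \<in> lists A"
  shows "(u @ z, v @ z) \<in> (prefix_step A R)\<^sup>*"
  using assms(1)
  by (induction rule: rtrancl_induct) (auto intro: rtrancl_into_rtrancl prefix_step_append[OF _ assms(2)])

text \<open>Rewriting a prefix rewrites the whole word. This closure under prefixes is what makes
  the normal forms span a tree.\<close>

lemma Irr_prefix: "u @ v \<in> Irr \<Longrightarrow> u \<in> Irr"
  unfolding irreducible_words_def using prefix_step_append[of u _ v] by fastforce

lemma Nil_Irr [simp]: "[] \<in> Irr"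
  using Irr_prefix[of "[]" "nf \<one>"] by simp

lemma nf_one [simp]: "nf \<one> = []"
  by (rule nf_eqI) auto

lemma prefix_step_facts:
  assumes "(u, v) \<in> prefix_step A R"
  shows "u \<in> lists A" "v \<in> lists A" "val u = val v" "weight v \<le> weight u"
proof -
  obtain x y z where "(x, y) \<in> R" "z \<in> lists A" "u = x @ z" "v = y @ z"
    using assms by (auto simp: prefix_step_def)
  then show "u \<in> lists A" "v \<in> lists A" "val u = val v" "weight v \<le> weight u"
    using R_lists[of x y] R_val[of x y] R_weight[of x y] by (auto simp: val_append)
qed

lemma wf_prefix_step: "wf ((prefix_step A R)\<inverse>)"
  using convergent by (simp add: convergent_prs_def wf_iff_no_infinite_down_chain)

text \<open>No step changes the value, so rewriting can end only in the unique irreducible word for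
  it, and no step raises the weight. Hence normal forms have least weight among the words for an
  element.\<close>

lemma reduces_to_nf:
  "u \<in> lists A \<Longrightarrow> (u, nf (val u)) \<in> (prefix_step A R)\<^sup>* \<and> weight (nf (val u)) \<le> weight u"
proof (induction u rule: wf_induct_rule[OF wf_prefix_step])
  case (1 u)
  show ?case
  proof (cases "u \<in> Irr")
    case True
    then show ?thesis by (simp add: nf_val)
  next
    case False
    then obtain v where v: "(u, v) \<in> prefix_step A R"
      using 1(2) by (auto simp: irreducible_words_def)
    note facts = prefix_step_facts[OF v]
    have "(v, nf (val v)) \<in> (prefix_step A R)\<^sup>* \<and> weight (nf (val v)) \<le> weight v"
      using 1(1)[of v] v facts(2) by simp
    then show ?thesis using v facts by (auto intro: converse_rtrancl_into_rtrancl)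
  qed
qed

text \<open>The weighted word norm: the least weight of a word for \<open>g\<close>, by
  \<open>wnorm_val_le\<close>.\<close>

definition wnorm :: "'a \<Rightarrow> real" where
  "wnorm g = weight (nf g)"

lemma wnorm_val_le: "u \<in> lists A \<Longrightarrow> wnorm (val u) \<le> weight u"
  using reduces_to_nf by (simp add: wnorm_def)

lemma wnorm_mult_le:
  assumes "g \<in> carrier G" and "h \<in> carrier G"
  shows "wnorm (g \<otimes> h) \<le> wnorm g + wnorm h"
  using wnorm_val_le[of "nf g @ nf h"] assms by (simp add: val_append wnorm_def)

lemma wnorm_val_Irr: "w \<in> Irr \<Longrightarrow> wnorm (val w) = weight w"
  by (simp add: wnorm_def nf_val)

text \<open>A left side ending inside \<open>w\<close> would make \<open>w\<close> reducible, so the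
  left side is all of \<open>w @ [a]\<close>. Thus the rule runs alongside the whole of
  \<open>w\<close>.\<close>

lemma rule_of_reducible_extension:
  assumes "w \<in> Irr" and "a \<in> A" and "w @ [a] \<notin> Irr"
  obtains v where "(w @ [a], v) \<in> R"
proof -
  have "w @ [a] \<in> lists A" using assms Irr_lists by auto
  then obtain u v z where uv: "(u, v) \<in> R" "z \<in> lists A" "w @ [a] = u @ z"
    using assms(3) by (auto simp: irreducible_words_def prefix_step_def)
  show thesis
  proof (cases z rule: rev_cases)
    case Nil
    then show thesis using uv that by simp
  next
    case (snoc z' b)
    then have "w = u @ z'" "z' \<in> lists A" using uv by auto
    then have "(w, v @ z') \<in> prefix_step A R" using uv by (auto simp: prefix_step_def)
    then show thesis using assms(1) by (auto simp: irreducible_words_def)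
  qed
qed

section \<open>The spanning tree of normal forms\<close>

text \<open>The two alternatives are the two orientations of an edge, away from the root and towards
  it; together they make the arcs closed under reversal.\<close>

definition nf_tree :: "('a, 'a \<times> 'a) pre_digraph" where
  "nf_tree = \<lparr> verts = carrier G,
     arcs = {(y, a). y \<in> carrier G \<and> a \<in> A \<and> (nf y @ [a] \<in> Irr \<or> nf (y \<otimes> a) @ [inv a] \<in> Irr)},
     tail = fst, head = (\<lambda>(y, a). y \<otimes> a) \<rparr>"

section \<open>Words as paths in the Cayley graph\<close>

definition word_inv :: "'a list \<Rightarrow> 'a list" where
  "word_inv w = rev (map (m_inv G) w)"

primrec edge_path :: "'a \<Rightarrow> 'a list \<Rightarrow> ('a \<times> 'a) list" where
  "edge_path g [] = []"
| "edge_path g (a # w) = (g, a) # edge_path (g \<otimes> a) w"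

lemma word_inv_simps [simp]:
  "word_inv [] = []" "word_inv (a # w) = word_inv w @ [inv a]"
  "word_inv (u @ v) = word_inv v @ word_inv u"
  by (simp_all add: word_inv_def)

lemma word_inv_lists [simp]: "w \<in> lists A \<Longrightarrow> word_inv w \<in> lists A"
  by (induction w) (auto intro: inv_in_A)

lemma val_word_inv: "w \<in> lists A \<Longrightarrow> val (word_inv w) = inv (val w)"
  by (induction w) (auto simp: val_append inv_in_A inv_mult_group word_inv_lists simp del: in_lists_conv_set)

lemma edge_path_append:
  "g \<in> carrier G \<Longrightarrow> u \<in> lists A \<Longrightarrow> edge_path g (u @ v) = edge_path g u @ edge_path (g \<otimes> val u) v"
  by (induction u arbitrary: g) (auto simp: m_assoc)

lemma path_label_edge_path [simp]: "path_label (edge_path g w) = w"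
  by (induction w arbitrary: g) (auto simp: path_label_def)

lemma length_edge_path [simp]: "length (edge_path g w) = length w"
  by (induction w arbitrary: g) auto

lemma in_edge_pathE:
  assumes "e \<in> set (edge_path g w)" and "g \<in> carrier G" and "w \<in> lists A"
  obtains u b v where "w = u @ b # v" and "e = (g \<otimes> val u, b)"
  using assms
proof (induction w arbitrary: g thesis)
  case (Cons a w)
  show ?case
  proof (cases "e = (g, a)")
    case True
    then show ?thesis using Cons.prems(1)[of "[]" a w] Cons.prems(3) by simp
  next
    case False
    then have "e \<in> set (edge_path (g \<otimes> a) w)" using Cons.prems(2) by simp
    then obtain u b v where uv: "w = u @ b # v" "e = (g \<otimes> a \<otimes> val u, b)"
      using Cons.IH[of "g \<otimes> a"] Cons.prems(3,4) by auto
    then show ?thesis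
      using Cons.prems(1)[of "a # u" b v] Cons.prems(3,4) by (auto simp: m_assoc)
  qed
qed simp

lemma path_label_lists: "set p \<subseteq> carrier G \<times> A \<Longrightarrow> path_label p \<in> lists A"
  by (fastforce simp: path_label_def)

text \<open>\<open>H\<close> is left open so as to cover both the Cayley graph and the tree.\<close>

lemma cas_iff_edge_path:
  assumes "tail H = fst" and "head H = (\<lambda>(y, a). y \<otimes> a)"
    and "u \<in> carrier G" and "set p \<subseteq> carrier G \<times> A"
  shows "pre_digraph.cas H u p v \<longleftrightarrow> p = edge_path u (path_label p) \<and> v = u \<otimes> val (path_label p)"
  using assms(3,4)
proof (induction p arbitrary: u)
  case Nil
  then show ?case by (auto simp: pre_digraph.cas.simps path_label_def)
next
  case (Cons e p)
  obtain y a where e: "e = (y, a)" by fastforce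
  have "path_label p \<in> lists A" using Cons.prems by (intro path_label_lists) simp
  then show ?case
    using Cons.IH[of "u \<otimes> a"] Cons.prems e assms(1,2)
    by (auto simp: pre_digraph.cas.simps path_label_def m_assoc)
qed

lemma awalk_iff_edge_path:
  assumes "tail H = fst" and "head H = (\<lambda>(y, a). y \<otimes> a)"
    and "verts H = carrier G" and "arcs H \<subseteq> carrier G \<times> A"
  shows "pre_digraph.awalk H u p v \<longleftrightarrow> u \<in> carrier G \<and> set p \<subseteq> arcs H \<and>
    p = edge_path u (path_label p) \<and> v = u \<otimes> val (path_label p)"
  using cas_iff_edge_path[OF assms(1,2)] assms(3,4) unfolding pre_digraph.awalk_def by blast

lemma cayley_graph_simps [simp]:
  "verts (cayley_graph G A) = carrier G" "arcs (cayley_graph G A) = carrier G \<times> A"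
  "tail (cayley_graph G A) = fst" "head (cayley_graph G A) = (\<lambda>(y, a). y \<otimes> a)"
  by (simp_all add: cayley_graph_def)

lemma nf_tree_simps [simp]:
  "verts nf_tree = carrier G" "tail nf_tree = fst" "head nf_tree = (\<lambda>(y, a). y \<otimes> a)"
  by (simp_all add: nf_tree_def)

section \<open>Walks in the tree of normal forms\<close>

lemma in_arcs_nf_tree:
  "(y, a) \<in> arcs nf_tree \<longleftrightarrow>
    y \<in> carrier G \<and> a \<in> A \<and> (nf y @ [a] \<in> Irr \<or> nf (y \<otimes> a) @ [inv a] \<in> Irr)"
  by (simp add: nf_tree_def)

lemma arcs_nf_tree_sub: "arcs nf_tree \<subseteq> carrier G \<times> A"
  by (auto simp: nf_tree_def)

lemma awalk_nf_tree:
  "pre_digraph.awalk nf_tree u p v \<longleftrightarrow> u \<in> carrier G \<and> set p \<subseteq> arcs nf_tree \<and>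
    p = edge_path u (path_label p) \<and> v = u \<otimes> val (path_label p)"
  by (rule awalk_iff_edge_path) (simp_all add: arcs_nf_tree_sub)

lemma rev_edge_nf_tree:
  assumes "e \<in> arcs nf_tree"
  shows "rev_edge G e \<in> arcs nf_tree"
proof -
  obtain y a where e: "e = (y, a)" by fastforce
  then have "y \<in> carrier G" "a \<in> A" "nf y @ [a] \<in> Irr \<or> nf (y \<otimes> a) @ [inv a] \<in> Irr"
    using assms by (auto simp: in_arcs_nf_tree)
  then show ?thesis
    by (auto simp: e rev_edge_def in_arcs_nf_tree inv_in_A m_assoc)
qed

lemma down_path_nf_tree:
  "x @ s \<in> Irr \<Longrightarrow> set (edge_path (val x) s) \<subseteq> arcs nf_tree"
proof (induction s arbitrary: x)
  case (Cons a s)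
  have x: "x \<in> Irr" "x @ [a] \<in> Irr" "x \<in> lists A" "a \<in> A"
    using Irr_prefix[of x "a # s"] Irr_prefix[of "x @ [a]" s] Irr_lists[OF Cons.prems] Cons.prems by auto
  then have "(val x, a) \<in> arcs nf_tree" by (simp add: in_arcs_nf_tree nf_val)
  moreover have "set (edge_path (val (x @ [a])) s) \<subseteq> arcs nf_tree"
    using Cons by simp
  ultimately show ?case using x by (simp add: val_append)
qed simp

lemma up_path_nf_tree:
  "x @ s \<in> Irr \<Longrightarrow> set (edge_path (val (x @ s)) (word_inv s)) \<subseteq> arcs nf_tree"
proof (induction s rule: rev_induct)
  case (snoc a s)
  have xs: "x @ s \<in> Irr" "x @ s @ [a] \<in> Irr" "x @ s \<in> lists A" "a \<in> A"
    using Irr_prefix[of "x @ s" "[a]"] Irr_lists[OF snoc.prems] snoc.prems by auto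
  have vals: "val (x @ s @ [a]) = val (x @ s) \<otimes> a"
    using val_append[of "x @ s" "[a]"] xs by simp
  have "(val (x @ s), a) \<in> arcs nf_tree"
    using xs by (simp add: in_arcs_nf_tree nf_val)
  from rev_edge_nf_tree[OF this] have "(val (x @ s @ [a]), inv a) \<in> arcs nf_tree"
    by (simp add: rev_edge_def vals)
  moreover have "val (x @ s @ [a]) \<otimes> inv a = val (x @ s)"
    unfolding vals using xs by (simp add: m_assoc)
  ultimately show ?case using snoc.IH xs(1) by simp
qed simp

lemma non_backtracking_snocD:
  assumes "non_backtracking G (edge_path u (w @ [a]))"
    and "u \<in> carrier G" and "w \<in> lists A"
  shows "non_backtracking G (edge_path u w)" and "w \<noteq> [] \<Longrightarrow> a \<noteq> inv (last w)"
proof -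
  have path: "edge_path u (w @ [a]) = edge_path u w @ [(u \<otimes> val w, a)]"
    using assms by (simp add: edge_path_append)
  show "non_backtracking G (edge_path u w)"
    using assms(1) unfolding path non_backtracking_def by (auto simp: nth_append) (metis Suc_lessD)
  assume "w \<noteq> []"
  then obtain w' b where w: "w = w' @ [b]" by (cases w rule: rev_cases) auto
  have b: "b \<in> A" "w' \<in> lists A" using assms(3) w by auto
  have "edge_path u (w @ [a]) = edge_path u w' @ [(u \<otimes> val w', b), (u \<otimes> val w, a)]"
    unfolding path using w b assms(2) by (simp add: edge_path_append)
  then have "(u \<otimes> val w, a) \<noteq> rev_edge G (u \<otimes> val w', b)"
    using assms(1) unfolding non_backtracking_def
    by (auto simp: nth_append dest!: spec[of _ "length w'"])
  then show "a \<noteq> inv (last w)"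
    using w b assms(2) by (auto simp: rev_edge_def val_append m_assoc)
qed

text \<open>
  A walk without backtracking climbs from \<open>u\<close> towards the root and then descends, since turning
  upwards after a step down would be a backtracking.
\<close>

lemma non_backtracking_tree_walk:
  assumes "u \<in> carrier G" and "w \<in> lists A" and "set (edge_path u w) \<subseteq> arcs nf_tree"
    and "non_backtracking G (edge_path u w)"
  shows "\<exists>x s t. nf u = x @ s \<and> nf (u \<otimes> val w) = x @ t \<and> w = word_inv s @ t \<and>
    (s = [] \<or> t = [] \<or> hd s \<noteq> hd t)"
  using assms(2-4)
proof (induction w rule: rev_induct)
  case Nil
  then show ?case using assms(1) by (intro exI[of _ "nf u"] exI[of _ "[]"]) auto
next
  case (snoc a w)
  have a: "a \<in> A" and w: "w \<in> lists A" using snoc.prems by auto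
  note nb = non_backtracking_snocD[OF snoc.prems(3) assms(1) w]
  define v where "v = u \<otimes> val w"
  have v: "v \<in> carrier G" using assms(1) w by (simp add: v_def)
  have path: "edge_path u (w @ [a]) = edge_path u w @ [(v, a)]"
    using assms(1) w by (simp add: edge_path_append v_def)
  obtain x s t where xst: "nf u = x @ s" "nf v = x @ t" "w = word_inv s @ t"
    "s = [] \<or> t = [] \<or> hd s \<noteq> hd t"
    using snoc.IH[OF w _ nb(1)] snoc.prems(2) unfolding path v_def by auto
  have s: "s \<in> lists A" using nf_lists[OF assms(1)] xst(1) by auto
  have v': "u \<otimes> val (w @ [a]) = v \<otimes> a"
    using assms(1) w a by (simp add: v_def val_append m_assoc)
  consider "nf v @ [a] \<in> Irr" | "nf (v \<otimes> a) @ [inv a] \<in> Irr"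
    using snoc.prems(2) unfolding path by (auto simp: in_arcs_nf_tree)
  then show ?case
  proof cases
    case 1
    have "nf (v \<otimes> a) = nf v @ [a]"
      using 1 v a by (intro nf_eqI) (auto simp: val_append)
    then have "nf (v \<otimes> a) = x @ t @ [a]" using xst(2) by simp
    \<comment> \<open>If \<open>t\<close> is empty and \<open>s = b # s'\<close>, the last step of
      \<open>w\<close> was \<open>inv b\<close>, and descending along \<open>b\<close> would undo
      it.\<close>
    moreover have "s = [] \<or> hd s \<noteq> hd (t @ [a])"
    proof (cases "s = [] \<or> t \<noteq> []")
      case True
      then show ?thesis using xst(4) by auto
    next
      case False
      then obtain b s' where "s = b # s'" "w = word_inv s' @ [inv b]"
        using xst(3) by (cases s) auto
      then show ?thesis using nb(2) s False by auto
    qed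
    ultimately show ?thesis
      unfolding v' using xst by (intro exI[of _ x] exI[of _ s] exI[of _ "t @ [a]"]) auto
  next
    case 2
    have nf_v: "nf v = nf (v \<otimes> a) @ [inv a]"
      using 2 v a by (intro nf_eqI) (auto simp: val_append inv_in_A m_assoc)
    show ?thesis
    proof (cases t rule: rev_cases)
      case Nil
      then have "nf u = nf (v \<otimes> a) @ inv a # s" using xst nf_v by simp
      then show ?thesis
        unfolding v' using xst Nil a
        by (intro exI[of _ "nf (v \<otimes> a)"] exI[of _ "inv a # s"] exI[of _ "[]"]) auto
    next
      case (snoc t' c)
      then have "c = inv a" using xst nf_v by auto
      then show ?thesis using nb(2) snoc xst(3) a by auto
    qed
  qed
qed

text \<open>At the root \<open>nf \<one> = []\<close> leaves no room for climbing, so the walk only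
  descends and spells \<open>nf g\<close>. Conversely, a backtracking along a normal form would
  yield two irreducible words of different lengths for one element.\<close>

lemma tree_path_nf_tree:
  assumes "g \<in> carrier G"
  shows "tree_path G nf_tree g p \<longleftrightarrow> p = edge_path \<one> (nf g)"
proof
  assume "tree_path G nf_tree g p"
  then have p: "set p \<subseteq> arcs nf_tree" "p = edge_path \<one> (path_label p)" "g = \<one> \<otimes> val (path_label p)"
    "non_backtracking G p"
    by (auto simp: tree_path_def awalk_nf_tree)
  have "path_label p \<in> lists A"
    using p(1) arcs_nf_tree_sub by (intro path_label_lists) blast
  then show "p = edge_path \<one> (nf g)"
    using non_backtracking_tree_walk[of \<one> "path_label p"] p by auto
next
  assume p: "p = edge_path \<one> (nf g)"
  have "set p \<subseteq> arcs nf_tree"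
    using down_path_nf_tree[of "[]" "nf g"] assms p by simp
  moreover have "non_backtracking G (edge_path \<one> w)" if "w \<in> Irr" for w
    using that
  proof (induction w rule: rev_induct)
    case Nil
    then show ?case by (simp add: non_backtracking_def)
  next
    case (snoc a w)
    have w: "w \<in> Irr" "w \<in> lists A" "a \<in> A"
      using Irr_prefix[OF snoc.prems] Irr_lists[OF snoc.prems] by auto
    show ?case
      unfolding non_backtracking_def
    proof (intro allI impI)
      fix i assume i: "Suc i < length (edge_path \<one> (w @ [a]))"
      have path: "edge_path \<one> (w @ [a]) = edge_path \<one> w @ [(val w, a)]"
        using w by (simp add: edge_path_append)
      show "edge_path \<one> (w @ [a]) ! Suc i \<noteq> rev_edge G (edge_path \<one> (w @ [a]) ! i)"
      proof (cases "Suc i < length w")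
        case True
        then show ?thesis
          using snoc.IH[OF w(1)] unfolding path by (simp add: nth_append non_backtracking_def)
      next
        case False
        then have len: "length w = Suc i" using i by simp
        then obtain w' b where w': "w = w' @ [b]" by (cases w rule: rev_cases) auto
        have b: "b \<in> A" "w' \<in> lists A" "w' \<in> Irr"
          using w w' Irr_prefix[of w' "[b]"] by auto
        have "a \<noteq> inv b"
        proof
          assume "a = inv b"
          then have "val (w @ [a]) = val w'"
            using b w' by (simp add: val_append inv_in_A m_assoc)
          then have "w @ [a] = w'"
            using nf_val[OF snoc.prems] nf_val[OF b(3)] by metis
          then have "length (w @ [a]) = length w'" by (rule arg_cong)
          then show False using w' by simp
        qed
        moreover have "edge_path \<one> (w @ [a]) ! i = (val w', b)"
          using w' b len by (simp add: path edge_path_append nth_append)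
        ultimately show ?thesis
          using len by (auto simp: path nth_append rev_edge_def)
      qed
    qed
  qed
  ultimately show "tree_path G nf_tree g p"
    using assms p by (auto simp: tree_path_def awalk_nf_tree)
qed

lemma tree_nf_nf_tree: "g \<in> carrier G \<Longrightarrow> tree_nf G nf_tree g = nf g"
  by (simp add: tree_nf_def tree_path_nf_tree)

lemma tree_path_labels:
  "{path_label p | p g. g \<in> carrier G \<and> tree_path G nf_tree g p} = Irr"
proof -
  have "\<exists>g. g \<in> carrier G \<and> w = nf g" if "w \<in> Irr" for w
    using nf_val[OF that] Irr_lists[OF that] by (metis val_closed)
  then show ?thesis by (force simp: tree_path_nf_tree)
qed

lemma cayley_spanning_tree_nf_tree: "cayley_spanning_tree G A nf_tree"
  unfolding cayley_spanning_tree_def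
proof (intro conjI ballI notI)
  have wf_tree: "wf_digraph nf_tree"
    by unfold_locales (auto simp: nf_tree_def)
  have "wf_digraph (cayley_graph G A)"
    by unfold_locales auto
  then show "spanning nf_tree (cayley_graph G A)"
    using wf_tree arcs_nf_tree_sub by (simp add: spanning_def subgraph_def compatible_def)
  show "rev_edge G e \<in> arcs nf_tree" if "e \<in> arcs nf_tree" for e
    using that by (rule rev_edge_nf_tree)
  show "strongly_connected nf_tree"
    unfolding strongly_connected_def
  proof (intro conjI ballI)
    fix u v assume "u \<in> verts nf_tree" "v \<in> verts nf_tree"
    then have uv: "u \<in> carrier G" "v \<in> carrier G" by auto
    \<comment> \<open>The path runs through the root: up from \<open>u\<close>, then down to
      \<open>v\<close>.\<close>
    let ?w = "word_inv (nf u) @ nf v"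
    have path: "edge_path u ?w = edge_path u (word_inv (nf u)) @ edge_path \<one> (nf v)"
      using uv by (simp add: edge_path_append val_word_inv)
    have "set (edge_path u ?w) \<subseteq> arcs nf_tree"
      using uv up_path_nf_tree[of "[]" "nf u"] down_path_nf_tree[of "[]" "nf v"]
      by (simp add: path)
    moreover have "v = u \<otimes> val ?w"
      using uv by (simp add: val_append val_word_inv flip: m_assoc)
    ultimately have "pre_digraph.awalk nf_tree u (edge_path u ?w) v"
      using uv by (simp add: awalk_nf_tree)
    then show "u \<rightarrow>\<^sup>*\<^bsub>nf_tree\<^esub> v"
      using wf_digraph.reachable_awalk[OF wf_tree] by blast
  qed auto
  assume "\<exists>p. pre_digraph.cycle nf_tree p \<and> non_backtracking G p"
  then obtain p u where p: "u \<in> carrier G" "set p \<subseteq> arcs nf_tree" "p = edge_path u (path_label p)"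
    "u = u \<otimes> val (path_label p)" "p \<noteq> []" "non_backtracking G p"
    by (auto simp: pre_digraph.cycle_def awalk_nf_tree)
  have "path_label p \<in> lists A"
    using p(2) arcs_nf_tree_sub by (intro path_label_lists) blast
  \<comment> \<open>On a closed walk \<open>x @ s = x @ t\<close>, so \<open>s = t\<close>; their
    first letters cannot differ, so both are empty and the cycle is trivial.\<close>
  then obtain x s t where "nf u = x @ s" "nf u = x @ t" "path_label p = word_inv s @ t"
    "s = [] \<or> t = [] \<or> hd s \<noteq> hd t"
    using non_backtracking_tree_walk[of u "path_label p"] p by metis
  then show False using p(5) by (auto simp: path_label_def)
qed

end

section \<open>Left quotients of the rewriting system\<close>

context weighted_prs
begin

text \<open>The same number of letters is removed from both sides, as a synchronous reading does;
  \<open>drop\<close> gives the empty word if \<open>v\<close> is already exhausted. The prefix of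
  \<open>v\<close> is forgotten on purpose.\<close>

definition tails :: "'a list \<Rightarrow> ('a list \<times> 'a list) set" where
  "tails x = {(y, drop (length x) v) | y v. (x @ y, v) \<in> R}"

text \<open>The word differences of the fellow-traveller property, between the vertices reached at
  equal times along the two sides of a rule.\<close>

definition prefix_diffs :: "'a set" where
  "prefix_diffs = {inv (val x) \<otimes> val (take (length x) v) | x y v. (x @ y, v) \<in> R}"

abbreviation padded_R :: "'a option list list set" where
  "padded_R \<equiv> pad_tuple ` {[u, v] | u v. (u, v) \<in> R}"

abbreviation pair_alphabet :: "'a option list set" where
  "pair_alphabet \<equiv> listset (map (\<lambda>A. insert None (Some ` A)) [A, A])"

lemma finite_quots_padded_R: "finite_quots pair_alphabet padded_R"
  using sync unfolding sync_regular_prs_def sync_regular_def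
  by (intro finite_quots_if_regular_language) simp

lemma padded_R_split:
  assumes "(x @ y, v) \<in> R"
  obtains c d where "c \<in> lists pair_alphabet" "d \<in> lquot padded_R c" "length c = length x"
    "component 0 c = x" "component 1 c = take (length x) v"
    "component 0 d = y" "component 1 d = drop (length x) v"
proof -
  let ?p = "pad_tuple [x @ y, v]"
  let ?c = "take (length x) ?p" and ?d = "drop (length x) ?p"
  have mem: "?p \<in> padded_R" using assms by blast
  then have "?p \<in> lists pair_alphabet"
    using finite_quots_padded_R unfolding finite_quots_def by blast
  then have "?c \<in> lists pair_alphabet" by (meson in_listsI in_listsD in_set_takeD)
  moreover have "?d \<in> lquot padded_R ?c" using mem by (simp add: lquot_def)
  moreover have "length ?c = length x" by (simp add: length_pad_tuple)
  moreover have "component 0 ?c = x" "component 1 ?c = take (length x) v"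
    "component 0 ?d = y" "component 1 ?d = drop (length x) v"
    using component_pad_tuple[of 0 "[x @ y, v]" "length x"] component_pad_tuple[of 1 "[x @ y, v]" "length x"]
    by simp_all
  ultimately show thesis by (rule that)
qed

lemma padded_R_join:
  assumes "d \<in> lquot padded_R c"
  obtains v where "(component 0 c @ component 0 d, v) \<in> R"
    "component 1 c = take (length c) v" "component 1 d = drop (length c) v"
proof -
  obtain u v where uv: "(u, v) \<in> R" "c @ d = pad_tuple [u, v]"
    using assms by (auto simp: lquot_def)
  have cd: "c = take (length c) (pad_tuple [u, v])" "d = drop (length c) (pad_tuple [u, v])"
    using uv(2) by (metis append_eq_conv_conj)+
  have comp: "component 0 c = take (length c) u" "component 0 d = drop (length c) u"
    "component 1 c = take (length c) v" "component 1 d = drop (length c) v"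
    using component_pad_tuple[of 0 "[u, v]" "length c"] component_pad_tuple[of 1 "[u, v]" "length c"]
    unfolding cd[symmetric] by simp_all
  show thesis by (rule that[of v]) (use uv(1) comp in simp_all)
qed

text \<open>A subset construction: forgetting the prefix of the right side makes the reading
  nondeterministic, so \<open>tails x\<close> is determined by a set of quotients, and these sets
  lie in a finite power set.\<close>

lemma finite_tails: "finite (tails ` lists A)"
proof -
  \<comment> \<open>The length condition excludes prefixes \<open>c\<close> that run on into the
    padding of the left side.\<close>
  define \<Theta> where "\<Theta> x = lquot padded_R ` {c \<in> lists pair_alphabet. length c = length x \<and> component 0 c = x}" for x
  have eq: "tails x = (\<lambda>d. (component 0 d, component 1 d)) ` \<Union> (\<Theta> x)" for x
  proof (intro equalityI subsetI)
    fix z assume "z \<in> tails x"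
    then obtain y v where z: "(x @ y, v) \<in> R" "z = (y, drop (length x) v)"
      by (auto simp: tails_def)
    obtain c d where c: "c \<in> lists pair_alphabet" "d \<in> lquot padded_R c" "length c = length x"
      "component 0 c = x" "component 1 c = take (length x) v"
      and d: "component 0 d = y" "component 1 d = drop (length x) v"
      by (rule padded_R_split[OF z(1)])
    have "lquot padded_R c \<in> \<Theta> x"
      unfolding \<Theta>_def using c(1,3,4) by blast
    then have "d \<in> \<Union> (\<Theta> x)" using c(2) by (rule UnionI)
    moreover have "z = (component 0 d, component 1 d)"
      using z(2) d by simp
    ultimately show "z \<in> (\<lambda>d. (component 0 d, component 1 d)) ` \<Union> (\<Theta> x)" by blast
  next
    fix z assume "z \<in> (\<lambda>d. (component 0 d, component 1 d)) ` \<Union> (\<Theta> x)"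
    then obtain c d where c: "d \<in> lquot padded_R c" "length c = length x" "component 0 c = x"
      and z: "z = (component 0 d, component 1 d)"
      unfolding \<Theta>_def by auto
    from c(1) obtain v where "(component 0 c @ component 0 d, v) \<in> R" "component 1 d = drop (length c) v"
      by (rule padded_R_join)
    then show "z \<in> tails x"
      unfolding tails_def using c z by auto
  qed
  have "\<Theta> ` lists A \<subseteq> Pow (lquot padded_R ` lists pair_alphabet)"
    unfolding \<Theta>_def by blast
  moreover have "finite (Pow (lquot padded_R ` lists pair_alphabet))"
    using finite_quots_padded_R by (simp only: finite_quots_def finite_Pow_iff)
  ultimately have "finite (\<Theta> ` lists A)" by (rule finite_subset)
  then show ?thesis by (rule finite_image_factor) (simp only: eq)
qed

text \<open>Hence \<open>tails\<close> behaves like the state of a deterministic automaton.\<close>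

lemma tails_append: "tails (x @ y) = {(z, drop (length y) t) | z t. (y @ z, t) \<in> tails x}"
  by (auto simp: tails_def) (metis add.commute drop_drop)+

text \<open>A rearrangement of \<open>val (x @ y) = val v\<close>. Its use is that the right-hand
  side involves only the remainders, so the difference is known without the prefixes.\<close>

lemma prefix_diff_eq:
  assumes "(x @ y, v) \<in> R"
  shows "inv (val x) \<otimes> val (take (length x) v) = val y \<otimes> inv (val (drop (length x) v))"
proof -
  let ?p = "val (take (length x) v)" and ?q = "val (drop (length x) v)"
  have l: "x \<in> lists A" "y \<in> lists A" "v \<in> lists A" using R_lists[OF assms] by auto
  then have td: "take (length x) v \<in> lists A" "drop (length x) v \<in> lists A"
    by (auto dest: in_set_takeD in_set_dropD)
  have "val x \<otimes> val y = ?p \<otimes> ?q"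
    using R_val[OF assms] val_append[of x y] val_append[OF td] l by simp
  then have "inv (val x) \<otimes> ?p = inv (val x) \<otimes> (val x \<otimes> val y \<otimes> inv ?q)"
    using td l by (simp add: m_assoc)
  also have "\<dots> = val y \<otimes> inv ?q"
    using td l by (simp flip: m_assoc)
  finally show ?thesis .
qed

text \<open>
  The two sides of a rule fellow-travel: the element \<open>x\<^sup>-\<^sup>1 v(|x|)\<close> is determined by any completion
  of the prefix pair, hence by the left quotient at this pair.
\<close>

lemma finite_prefix_diffs: "finite prefix_diffs"
proof -
  define f where "f Q = (let d = SOME d. d \<in> Q in val (component 0 d) \<otimes> inv (val (component 1 d)))" for Q
  have "prefix_diffs \<subseteq> f ` lquot padded_R ` lists pair_alphabet"
  proof
    fix h assume "h \<in> prefix_diffs"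
    then obtain x y v where h: "(x @ y, v) \<in> R" "h = inv (val x) \<otimes> val (take (length x) v)"
      by (auto simp: prefix_diffs_def)
    obtain c d where c: "c \<in> lists pair_alphabet" "d \<in> lquot padded_R c" "length c = length x"
      "component 0 c = x" "component 1 c = take (length x) v"
      by (rule padded_R_split[OF h(1)])
    define d' where "d' = (SOME d. d \<in> lquot padded_R c)"
    have "d' \<in> lquot padded_R c" unfolding d'_def by (rule someI) (rule c(2))
    then obtain v' where "(component 0 c @ component 0 d', v') \<in> R"
      "component 1 c = take (length c) v'" "component 1 d' = drop (length c) v'"
      by (rule padded_R_join)
    then have "(x @ component 0 d', v') \<in> R"
      "component 1 c = take (length x) v'" "component 1 d' = drop (length x) v'"
      by (simp_all only: c(3,4))
    then have "h = val (component 0 d') \<otimes> inv (val (component 1 d'))"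
      using prefix_diff_eq[of x "component 0 d'" v'] h(2) c(5) by simp
    then have "h = f (lquot padded_R c)" by (simp add: f_def d'_def Let_def)
    then show "h \<in> f ` lquot padded_R ` lists pair_alphabet" using c(1) by blast
  qed
  moreover have "finite (lquot padded_R ` lists pair_alphabet)"
    using finite_quots_padded_R by (simp only: finite_quots_def)
  ultimately show ?thesis by (meson finite_imageI finite_subset)
qed

lemma prefix_diffs_closed: "prefix_diffs \<subseteq> carrier G"
proof
  fix h assume "h \<in> prefix_diffs"
  then obtain x y v where h: "(x @ y, v) \<in> R" "h = inv (val x) \<otimes> val (take (length x) v)"
    by (auto simp: prefix_diffs_def)
  then have "x \<in> lists A" "take (length x) v \<in> lists A"
    using R_lists[OF h(1)] by (auto dest: in_set_takeD)
  then show "h \<in> carrier G" using h(2) by simp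
qed

text \<open>A left side that reduces \<open>x @ y\<close> either ends inside \<open>x\<close>, which
  irreducibility of \<open>x\<close> forbids, or extends into \<open>y\<close>, which
  \<open>tails x\<close> records. So these two data determine the quotient of \<open>Irr\<close> at
  \<open>x\<close>.\<close>

lemma append_Irr_iff:
  assumes "x \<in> lists A"
  shows "x @ y \<in> Irr \<longleftrightarrow> x \<in> Irr \<and> y \<in> lists A \<and> \<not> (\<exists>y1 y2 t. y = y1 @ y2 \<and> (y1, t) \<in> tails x)"
proof
  assume xy: "x @ y \<in> Irr"
  have "y \<in> lists A" using Irr_lists[OF xy] by simp
  moreover have "\<not> (y = y1 @ y2 \<and> (y1, t) \<in> tails x)" for y1 y2 t
  proof
    assume y: "y = y1 @ y2 \<and> (y1, t) \<in> tails x"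
    then obtain v where "(x @ y1, v) \<in> R" by (auto simp: tails_def)
    then have "(x @ y, v @ y2) \<in> prefix_step A R"
      unfolding prefix_step_def using y \<open>y \<in> lists A\<close>
      by (intro CollectI exI[of _ "x @ y1"] exI[of _ v] exI[of _ y2]) auto
    then show False using xy by (auto simp: irreducible_words_def)
  qed
  ultimately show "x \<in> Irr \<and> y \<in> lists A \<and> \<not> (\<exists>y1 y2 t. y = y1 @ y2 \<and> (y1, t) \<in> tails x)"
    using Irr_prefix[OF xy] by blast
next
  assume r: "x \<in> Irr \<and> y \<in> lists A \<and> \<not> (\<exists>y1 y2 t. y = y1 @ y2 \<and> (y1, t) \<in> tails x)"
  show "x @ y \<in> Irr"
  proof (rule ccontr)
    assume "x @ y \<notin> Irr"
    moreover have "x @ y \<in> lists A" using assms r by simp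
    ultimately obtain u v z where uv: "(u, v) \<in> R" "z \<in> lists A" "x @ y = u @ z"
      by (auto simp: irreducible_words_def prefix_step_def)
    then consider y1 where "u = x @ y1" "y = y1 @ z" | z' where "x = u @ z'"
      by (auto simp: append_eq_append_conv2)
    then show False
    proof cases
      case 1
      then have "(y1, drop (length x) v) \<in> tails x" using uv(1) by (auto simp: tails_def)
      then show False using r 1(2) by blast
    next
      case 2
      then have "z' \<in> lists A" using assms by simp
      then have "(x, v @ z') \<in> prefix_step A R" using 2 uv(1) by (auto simp: prefix_step_def)
      then show False using r by (auto simp: irreducible_words_def)
    qed
  qed
qed

lemma finite_quots_Irr: "finite_quots A Irr"
proof -
  have "(\<lambda>x. (x \<in> Irr, tails x)) ` lists A \<subseteq> UNIV \<times> tails ` lists A" by blast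
  moreover have "finite (UNIV \<times> tails ` lists A :: (bool \<times> _) set)"
    using finite_tails by simp
  ultimately have "finite ((\<lambda>x. (x \<in> Irr, tails x)) ` lists A)" by (rule finite_subset)
  then have "finite (lquot Irr ` lists A)"
    by (rule finite_image_factor) (simp add: lquot_def append_Irr_iff del: in_lists_conv_set)
  then show ?thesis using Irr_lists by (simp add: finite_quots_def subset_iff)
qed

text \<open>While reading, it is unknown where the cut \<open>k\<close> letters before the end will
  fall. The invariant \<open>f\<close> therefore buffers the data for all cuts at most
  \<open>k\<close> letters before the end of \<open>x\<close>. If the cut falls into the
  continuation \<open>y\<close>, \<open>tails x\<close> alone suffices; otherwise it lies
  \<open>k - length y\<close> letters before the end of \<open>x\<close>.\<close>

lemma finite_quots_tails_suffix:
  "finite_quots A {w \<in> lists A. P (tails (take (length w - k) w)) (drop (length w - k) w)}"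
    (is "finite_quots A ?L")
proof -
  define f where
    "f x = map (\<lambda>j. (tails (take (length x - j) x), drop (length x - j) x)) [0..<Suc k]" for x
  let ?S = "tails ` lists A \<times> {s. set s \<subseteq> A \<and> length s \<le> k}"
  have "f ` lists A \<subseteq> {l. set l \<subseteq> ?S \<and> length l = Suc k}"
    by (fastforce simp: f_def dest: in_set_takeD in_set_dropD)
  moreover have "finite {l. set l \<subseteq> ?S \<and> length l = Suc k}"
    using finite_tails finite_lists_length_le[OF finite_A]
    by (intro finite_lists_length_eq finite_cartesian_product) auto
  ultimately have "finite (f ` lists A)" by (rule finite_subset)
  then have "finite (lquot ?L ` lists A)"
  proof (rule finite_image_factor)
    fix x x' assume x: "x \<in> lists A" "x' \<in> lists A" and eq: "f x = f x'"
    have nth: "tails (take (length x - j) x) = tails (take (length x' - j) x') \<and>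
      drop (length x - j) x = drop (length x' - j) x'" if "j \<le> k" for j
      using arg_cong[OF eq, of "\<lambda>l. l ! j"] that by (simp add: f_def del: upt_Suc)
    have "tails (take (length (x @ y) - k) (x @ y)) = tails (take (length (x' @ y) - k) (x' @ y)) \<and>
      drop (length (x @ y) - k) (x @ y) = drop (length (x' @ y) - k) (x' @ y)" for y
    proof (cases "k \<le> length y")
      case True
      then have "length z + length y - k - length z = length y - k" "length z \<le> length z + length y - k" for z
        by auto
      then have "take (length (z @ y) - k) (z @ y) = z @ take (length y - k) y"
        "drop (length (z @ y) - k) (z @ y) = drop (length y - k) y" for z
        by simp_all
      moreover have "tails x = tails x'" using nth[of 0] by simp
      ultimately show ?thesis by (simp add: tails_append)
    next
      case False
      then have "length (z @ y) - k = length z - (k - length y)" for z by simp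
      then have "take (length (z @ y) - k) (z @ y) = take (length z - (k - length y)) z"
        "drop (length (z @ y) - k) (z @ y) = drop (length z - (k - length y)) z @ y" for z
        by simp_all
      then show ?thesis using nth[of "k - length y"] by simp
    qed
    then show "lquot ?L x = lquot ?L x'"
      using x by (simp add: lquot_def del: length_append take_append drop_append)
  qed
  then show ?thesis by (simp add: finite_quots_def)
qed

end

section \<open>The flow function\<close>

text \<open>\<open>K\<close> bounds a difference and its inverse separately: \<open>wt\<close> may
  weigh a letter and its inverse differently, so \<open>wnorm\<close> need not be symmetric.\<close>

locale weighted_prs_bounds = weighted_prs +
  fixes wmin wmax K :: real and k :: nat
  assumes wmin_pos: "0 < wmin" and wmin_le: "a \<in> A \<Longrightarrow> wmin \<le> wt a"
    and wmax_nonneg: "0 \<le> wmax" and wmax_ge: "a \<in> A \<Longrightarrow> wt a \<le> wmax"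
    and K_nonneg: "0 \<le> K"
    and K_ge: "h \<in> prefix_diffs \<Longrightarrow> wnorm h \<le> K \<and> wnorm (inv h) \<le> K"
    and k_large: "K + wmax < real k * wmin"

lemma (in weighted_prs) bounds_exist:
  "\<exists>wmin wmax K k. weighted_prs_bounds G A R wt wmin wmax K k"
proof -
  \<comment> \<open>The inserted numbers keep \<open>Min\<close> and \<open>Max\<close> meaningful
    when \<open>A\<close> or \<open>prefix_diffs\<close> is empty.\<close>
  define wmin where "wmin = Min (insert 1 (wt ` A))"
  define wmax where "wmax = Max (insert 0 (wt ` A))"
  define K where "K = Max (insert 0 (wnorm ` (prefix_diffs \<union> m_inv G ` prefix_diffs)))"
  have wmin: "0 < wmin" "\<And>a. a \<in> A \<Longrightarrow> wmin \<le> wt a"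
    using finite_A wt_pos by (auto simp: wmin_def)
  have wmax: "0 \<le> wmax" "\<And>a. a \<in> A \<Longrightarrow> wt a \<le> wmax"
    using finite_A by (auto simp: wmax_def intro: Max_ge)
  have fin: "finite (insert 0 (wnorm ` (prefix_diffs \<union> m_inv G ` prefix_diffs)))"
    using finite_prefix_diffs by simp
  have K: "0 \<le> K" "\<And>h. h \<in> prefix_diffs \<Longrightarrow> wnorm h \<le> K \<and> wnorm (inv h) \<le> K"
    unfolding K_def by (auto intro!: Max_ge[OF fin])
  obtain k where "K + wmax < real k * wmin"
    using reals_Archimedean3[OF wmin(1)] by blast
  then show ?thesis
    using wmin wmax K weighted_prs_axioms
    by (intro exI[of _ wmin] exI[of _ wmax] exI[of _ K] exI[of _ k])
      (simp add: weighted_prs_bounds_def weighted_prs_bounds_axioms_def)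
qed

context weighted_prs_bounds
begin

lemma weight_bounds:
  "w \<in> lists A \<Longrightarrow> real (length w) * wmin \<le> weight w \<and> weight w \<le> real (length w) * wmax"
proof (induction w)
  case (Cons a w)
  then show ?case using wmin_le[of a] wmax_ge[of a] by (auto simp: algebra_simps)
qed simp

lemma k_pos: "0 < k"
  using k_large K_nonneg wmax_nonneg by (cases k) auto

text \<open>
  With \<open>w = x s\<close> the normal form of the initial vertex, where \<open>s\<close> has length \<open>k\<close>, and a rule
  \<open>(w a, v)\<close>, the flow climbs along \<open>s\<close>, crosses over to the vertex reached by the prefix of \<open>v\<close>
  of length \<open>|x|\<close>, and follows the remainder \<open>t\<close> of \<open>v\<close>. As the choice of \<open>t\<close> depends only on
  the left quotient \<open>X\<close> at \<open>x\<close> and on \<open>s\<close>, the flow is recognised by a finite automaton.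
\<close>

definition label_of :: "'a \<Rightarrow> ('a list \<times> 'a list) set \<Rightarrow> 'a list \<Rightarrow> 'a list" where
  "label_of a X s = (if (\<nexists>t. (s @ [a], t) \<in> X) \<or> (s \<noteq> [] \<and> last s = inv a) then [a]
     else let t = (SOME t. (s @ [a], t) \<in> X)
       in word_inv s @ nf (val (s @ [a]) \<otimes> inv (val t)) @ t)"

definition flow_label :: "'a list \<Rightarrow> 'a \<Rightarrow> 'a list" where
  "flow_label w a = label_of a (tails (take (length w - k) w)) (drop (length w - k) w)"

definition flow :: "'a \<times> 'a \<Rightarrow> ('a \<times> 'a) list" where
  "flow e = edge_path (fst e) (flow_label (nf (fst e)) (snd e))"

text \<open>\<open>label_of\<close> branches on membership in the tree, so this must be readable
  from \<open>tails x\<close> and \<open>s\<close>. As \<open>k\<close> is positive, the last letter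
  of \<open>w\<close> belongs to \<open>s\<close>.\<close>

lemma tree_edge_iff:
  assumes w: "w \<in> Irr" and a: "a \<in> A"
  defines "x \<equiv> take (length w - k) w" and "s \<equiv> drop (length w - k) w"
  shows "(val w, a) \<in> arcs nf_tree \<longleftrightarrow>
    (\<nexists>t. (s @ [a], t) \<in> tails x) \<or> (s \<noteq> [] \<and> last s = inv a)"
proof -
  have lw: "w \<in> lists A" using Irr_lists[OF w] .
  have xs: "x @ s = w" by (simp add: x_def s_def)
  have "(\<exists>t. (s @ [a], t) \<in> tails x) \<longleftrightarrow> (\<exists>v. (w @ [a], v) \<in> R)"
    unfolding tails_def using xs by (auto simp flip: append_assoc)
  also have "\<dots> \<longleftrightarrow> w @ [a] \<notin> Irr"
  proof
    assume "\<exists>v. (w @ [a], v) \<in> R"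
    then obtain v where "(w @ [a], v) \<in> R" ..
    then have "(w @ [a], v) \<in> prefix_step A R" by (force simp: prefix_step_def)
    then show "w @ [a] \<notin> Irr" by (auto simp: irreducible_words_def)
  qed (use rule_of_reducible_extension[OF w a] in blast)
  finally have down: "w @ [a] \<in> Irr \<longleftrightarrow> (\<nexists>t. (s @ [a], t) \<in> tails x)" by blast
  have "s = [] \<longleftrightarrow> w = []" using k_pos by (cases w) (auto simp: s_def)
  moreover have "last s = last w" if "s \<noteq> []" using xs that by (metis last_appendR)
  ultimately have last: "s \<noteq> [] \<and> last s = inv a \<longleftrightarrow> w \<noteq> [] \<and> last w = inv a" by metis
  have "nf (val w \<otimes> a) @ [inv a] \<in> Irr \<longleftrightarrow> w \<noteq> [] \<and> last w = inv a"
  proof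
    assume "nf (val w \<otimes> a) @ [inv a] \<in> Irr"
    moreover have "val (nf (val w \<otimes> a) @ [inv a]) = val w"
      using lw a by (simp add: val_append inv_in_A m_assoc)
    ultimately have "w = nf (val w \<otimes> a) @ [inv a]"
      using nf_val[OF w] nf_eqI by metis
    then show "w \<noteq> [] \<and> last w = inv a" by (metis last_snoc snoc_eq_iff_butlast)
  next
    assume "w \<noteq> [] \<and> last w = inv a"
    then obtain u where u: "w = u @ [inv a]" by (metis append_butlast_last_id)
    then have "u \<in> Irr" "u \<in> lists A" using w lw Irr_prefix by auto
    then have "nf (val w \<otimes> a) = u"
      using a u by (intro nf_eqI) (auto simp: val_append inv_in_A m_assoc)
    then show "nf (val w \<otimes> a) @ [inv a] \<in> Irr" using w u by simp
  qed
  then show ?thesis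
    using down last w lw a by (auto simp: in_arcs_nf_tree nf_val)
qed

lemma flow_label_tree:
  "w \<in> Irr \<Longrightarrow> a \<in> A \<Longrightarrow> (val w, a) \<in> arcs nf_tree \<Longrightarrow> flow_label w a = [a]"
  using tree_edge_iff by (simp add: flow_label_def label_of_def)

text \<open>Here \<open>y\<close> is the prefix of the right side of length \<open>length x\<close>.
  If \<open>w\<close> has at most \<open>k\<close> letters, both \<open>x\<close> and
  \<open>y\<close> are empty and \<open>h\<close> is trivial: little is gained by climbing, but
  there is also no crossing.\<close>

lemma flow_label_non_tree:
  assumes w: "w \<in> Irr" and a: "a \<in> A" and "(val w, a) \<notin> arcs nf_tree"
  obtains x s y t h where "w = x @ s" "x = [] \<or> length s = k" "length s \<le> k"
    "(w @ [a], y @ t) \<in> R" "x = [] \<longrightarrow> y = []"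
    "h = inv (val x) \<otimes> val y" "h = val (s @ [a]) \<otimes> inv (val t)" "h \<in> prefix_diffs"
    "flow_label w a = word_inv s @ nf h @ t"
proof -
  define x where "x = take (length w - k) w"
  define s where "s = drop (length w - k) w"
  define t where "t = (SOME t. (s @ [a], t) \<in> tails x)"
  define h where "h = val (s @ [a]) \<otimes> inv (val t)"
  have non_tree: "\<not> ((\<nexists>t. (s @ [a], t) \<in> tails x) \<or> (s \<noteq> [] \<and> last s = inv a))"
    using tree_edge_iff[OF w a] assms(3) unfolding x_def s_def by blast
  then have "\<exists>t. (s @ [a], t) \<in> tails x" by simp
  then have "(s @ [a], t) \<in> tails x"
    unfolding t_def by (rule someI_ex)
  then obtain v where v: "(x @ s @ [a], v) \<in> R" "t = drop (length x) v"
    by (auto simp: tails_def)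
  have xs: "w = x @ s" by (simp add: x_def s_def)
  show thesis
  proof (rule that[of x s "take (length x) v" t h])
    show "w = x @ s" by (rule xs)
    show "x = [] \<or> length s = k" "length s \<le> k" by (auto simp: x_def s_def)
    show "(w @ [a], take (length x) v @ t) \<in> R" using v by (simp add: xs)
    show "h = val (s @ [a]) \<otimes> inv (val t)" by (rule h_def)
    show "h = inv (val x) \<otimes> val (take (length x) v)"
      unfolding h_def v(2) using prefix_diff_eq[OF v(1)] by simp
    then show "h \<in> prefix_diffs" using v(1) unfolding prefix_diffs_def by blast
    show "flow_label w a = word_inv s @ nf h @ t"
      using non_tree
      unfolding flow_label_def label_of_def x_def[symmetric] s_def[symmetric] h_def t_def Let_def
      by (simp only: if_False)
  qed simp
qed

text \<open>The bound adds up climb, crossing and remainder. For the remainder, \<open>x\<close> is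
  geodesic, so \<open>weight x \<le> weight y + K\<close>; as the rule does not increase weight,
  \<open>t\<close> exceeds \<open>s @ [a]\<close> by at most \<open>K\<close>.\<close>

lemma flow_label_facts:
  assumes w: "w \<in> Irr" and a: "a \<in> A"
  shows "flow_label w a \<in> lists A" and "val (flow_label w a) = a"
    and "weight (flow_label w a) \<le> real k * wmax + K + (real k * wmax + wmax + K)"
proof -
  have "flow_label w a \<in> lists A \<and> val (flow_label w a) = a \<and>
    weight (flow_label w a) \<le> real k * wmax + K + (real k * wmax + wmax + K)"
  proof (cases "(val w, a) \<in> arcs nf_tree")
    case True
    have "wt a \<le> c + K + (c + wmax + K)" if "0 \<le> c" for c
      using that wmax_ge[OF a] wmax_nonneg K_nonneg by linarith
    then have "wt a \<le> real k * wmax + K + (real k * wmax + wmax + K)" using wmax_nonneg by simp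
    then show ?thesis using flow_label_tree[OF w a True] a by simp
  next
    case False
    obtain x s y t h where "x = [] \<or> length s = k" "x = [] \<longrightarrow> y = []"
      and ws: "w = x @ s" "length s \<le> k" "(w @ [a], y @ t) \<in> R"
      and h: "h = inv (val x) \<otimes> val y" "h = val (s @ [a]) \<otimes> inv (val t)" "h \<in> prefix_diffs"
      and label: "flow_label w a = word_inv s @ nf h @ t"
      by (rule flow_label_non_tree[OF w a False])
    have l: "x \<in> lists A" "s \<in> lists A" "y \<in> lists A" "t \<in> lists A"
      using R_lists[OF ws(3)] ws(1) by auto
    have hc: "h \<in> carrier G" using h(3) prefix_diffs_closed by blast
    have "val (word_inv s @ nf h @ t) = inv (val s) \<otimes> (val (s @ [a]) \<otimes> inv (val t) \<otimes> val t)"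
      using l hc h(2) by (simp add: val_append val_word_inv del: in_lists_conv_set)
    also have "\<dots> = a"
      using l a by (simp add: val_append m_assoc) (simp flip: m_assoc)
    finally have val: "val (flow_label w a) = a" by (simp add: label)
    have len: "real (length s) * wmax \<le> real k * wmax"
      using ws(2) wmax_nonneg by (intro mult_right_mono) auto
    have "length (word_inv s) = length s" by (simp add: word_inv_def)
    then have s_weight: "weight s \<le> real k * wmax" "weight (word_inv s) \<le> real k * wmax"
      using weight_bounds[of s] weight_bounds[of "word_inv s"] l len by auto
    have "x \<in> Irr" using w ws(1) Irr_prefix by blast
    then have "weight x = wnorm (val x)" by (simp add: wnorm_val_Irr)
    also have "val x = val y \<otimes> inv h"
      using l h(1) by (simp add: inv_mult_group) (simp flip: m_assoc)
    also have "wnorm (val y \<otimes> inv h) \<le> wnorm (val y) + wnorm (inv h)"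
      using l hc by (intro wnorm_mult_le) auto
    also have "\<dots> \<le> weight y + K"
      using wnorm_val_le[of y] K_ge[OF h(3)] l by auto
    finally have "weight x \<le> weight y + K" .
    moreover have "weight y + weight t \<le> weight x + weight s + wt a"
      using R_weight[OF ws(3)] ws(1) by simp
    ultimately have "weight t \<le> real k * wmax + wmax + K"
      using s_weight wmax_ge[OF a] by simp
    moreover have "weight (nf h) \<le> K" using K_ge[OF h(3)] by (simp add: wnorm_def)
    ultimately have "weight (flow_label w a) \<le> real k * wmax + K + (real k * wmax + wmax + K)"
      using s_weight unfolding label weight_simps by linarith
    then show ?thesis using val l hc by (simp add: label del: in_lists_conv_set)
  qed
  then show "flow_label w a \<in> lists A" "val (flow_label w a) = a"
    "weight (flow_label w a) \<le> real k * wmax + K + (real k * wmax + wmax + K)" by auto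
qed

definition max_len :: nat where
  "max_len = nat \<lceil>(real k * wmax + K + (real k * wmax + wmax + K)) / wmin\<rceil>"

lemma length_flow_label:
  assumes "w \<in> Irr" and "a \<in> A"
  shows "length (flow_label w a) \<le> max_len"
proof -
  have "real (length (flow_label w a)) * wmin \<le> real k * wmax + K + (real k * wmax + wmax + K)"
    using weight_bounds flow_label_facts[OF assms] order_trans by blast
  then have "real (length (flow_label w a)) \<le> (real k * wmax + K + (real k * wmax + wmax + K)) / wmin"
    using wmin_pos by (simp add: pos_le_divide_eq)
  then show ?thesis unfolding max_len_def by linarith
qed

section \<open>Termination of the flow\<close>

definition edge_weight :: "'a \<times> 'a \<Rightarrow> real" where
  "edge_weight e = wnorm (fst e) + wt (snd e)"

text \<open>Climbing edges lie in the tree. Crossing edges are strictly lighter by the choice of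
  \<open>k\<close>. An edge along \<open>t\<close> ends a prefix of the right side of a rule, which
  is no heavier than \<open>w @ [a]\<close>.\<close>

lemma flow_non_tree_edge:
  assumes w: "w \<in> Irr" and a: "a \<in> A" and "(val w, a) \<notin> arcs nf_tree"
    and e: "e \<in> set (flow (val w, a))" "e \<notin> arcs nf_tree"
  shows "edge_weight e < edge_weight (val w, a) \<or>
    edge_weight e \<le> edge_weight (val w, a) \<and>
    (\<exists>u b z. (w @ [a], u @ b # z) \<in> R \<and> e = (val u, b))"
proof -
  obtain x s y t h where ws: "w = x @ s" "x = [] \<or> length s = k" "(w @ [a], y @ t) \<in> R"
    "x = [] \<longrightarrow> y = []"
    and h: "h = inv (val x) \<otimes> val y" "h \<in> prefix_diffs"
    and label: "flow_label w a = word_inv s @ nf h @ t"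
    by (rule flow_label_non_tree[OF w a assms(3)])
  have l: "x \<in> lists A" "s \<in> lists A" "y \<in> lists A" "t \<in> lists A" "w \<in> lists A"
    using R_lists[OF ws(3)] ws(1) by auto
  have hc: "h \<in> carrier G" using h(2) prefix_diffs_closed by blast
  have x: "x \<in> Irr" using w ws(1) Irr_prefix by blast
  have vx: "val w \<otimes> val (word_inv s) = val x"
    using l ws(1) by (simp add: val_append val_word_inv m_assoc del: in_lists_conv_set)
  have vy: "val x \<otimes> h = val y"
    using l h(1) by (simp flip: m_assoc)
  have "flow (val w, a) = edge_path (val w) (word_inv s) @ edge_path (val x) (nf h) @ edge_path (val y) t"
    using l hc by (simp add: flow_def label nf_val[OF w] edge_path_append vx vy del: in_lists_conv_set)
  moreover have "e \<notin> set (edge_path (val w) (word_inv s))"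
    using up_path_nf_tree[of x s] w ws(1) e(2) by blast
  ultimately consider "e \<in> set (edge_path (val x) (nf h))" | "e \<in> set (edge_path (val y) t)"
    using e(1) by auto
  then show ?thesis
  proof cases
    case 1
    then obtain u b z where u: "nf h = u @ b # z" "e = (val x \<otimes> val u, b)"
      using in_edge_pathE[of e "val x" "nf h"] l hc by (metis nf_lists val_closed)
    have ub: "u \<in> lists A" "b \<in> A" "z \<in> lists A" using nf_lists[OF hc] u(1) by auto
    \<comment> \<open>Only for nonempty \<open>x\<close> does \<open>s\<close> have the full length
      \<open>k\<close>, on which the strict decrease rests.\<close>
    have "x \<noteq> []"
    proof
      assume "x = []"
      then have "nf h = []" using h(1) ws(4) by simp
      then show False using u(1) by simp
    qed
    then have "real k * wmin \<le> weight s" using ws(2) weight_bounds[of s] l by auto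
    moreover have "wnorm (val x \<otimes> val u) \<le> weight x + weight u"
      using wnorm_val_le[of "x @ u"] l ub by (simp add: val_append del: in_lists_conv_set)
    moreover have "weight u \<le> K"
      using K_ge[OF h(2)] weight_nonneg[OF ub(3)] wt_pos[OF ub(2)] u(1) by (simp add: wnorm_def)
    moreover have "wnorm (val w) = weight x + weight s"
      using wnorm_val_Irr[OF w] ws(1) by simp
    ultimately have "edge_weight e < edge_weight (val w, a)"
      using k_large wmax_ge[OF ub(2)] wt_pos[OF a] u(2) by (simp add: edge_weight_def)
    then show ?thesis ..
  next
    case 2
    then obtain u b z where u: "t = u @ b # z" "e = (val y \<otimes> val u, b)"
      using in_edge_pathE[of e "val y" t] l by (metis val_closed)
    have ub: "u \<in> lists A" "b \<in> A" "z \<in> lists A" using l(4) u(1) by auto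
    have rule: "(w @ [a], (y @ u) @ b # z) \<in> R" using ws(3) u(1) by simp
    have e': "e = (val (y @ u), b)" using u(2) l ub by (simp add: val_append)
    have "wnorm (val (y @ u)) \<le> weight (y @ u)"
      using wnorm_val_le[of "y @ u"] l ub by simp
    moreover have "weight (y @ u) + wt b + weight z \<le> weight w + wt a"
      using R_weight[OF rule] by simp
    moreover have "wnorm (val w) = weight w"
      using wnorm_val_Irr[OF w] .
    ultimately have "edge_weight e \<le> edge_weight (val w, a)"
      using weight_nonneg[OF ub(3)] by (simp add: edge_weight_def e')
    then show ?thesis using rule e' by blast
  qed
qed

text \<open>Weights are real, so monotonicity alone would not make them stabilise. As each letter
  weighs at least \<open>wmin\<close>, only finitely many words weigh at most
  \<open>c\<close>.\<close>

lemma finite_edge_weights: "finite (edge_weight ` {e \<in> carrier G \<times> A. edge_weight e \<le> c})"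
proof -
  let ?W = "{w. set w \<subseteq> A \<and> length w \<le> nat \<lceil>c / wmin\<rceil>}"
  have "edge_weight e \<in> weight ` ?W" if e: "e \<in> carrier G \<times> A" "edge_weight e \<le> c" for e
  proof
    let ?g = "fst e" and ?a = "snd e"
    have "?g \<in> carrier G" "?a \<in> A" using e(1) by auto
    then have l: "nf ?g @ [?a] \<in> lists A" using nf_lists[of ?g] by simp
    show "edge_weight e = weight (nf ?g @ [?a])"
      by (simp add: edge_weight_def wnorm_def)
    then have "real (length (nf ?g @ [?a])) * wmin \<le> c"
      using weight_bounds[OF l] e(2) by simp
    then have "real (length (nf ?g @ [?a])) \<le> c / wmin"
      using wmin_pos by (simp add: pos_le_divide_eq)
    then have "length (nf ?g @ [?a]) \<le> nat \<lceil>c / wmin\<rceil>" by linarith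
    then show "nf ?g @ [?a] \<in> ?W" using l by auto
  qed
  then have "edge_weight ` {e \<in> carrier G \<times> A. edge_weight e \<le> c} \<subseteq> weight ` ?W" by blast
  moreover have "finite (weight ` ?W)" using finite_lists_length_le[OF finite_A] by blast
  ultimately show ?thesis by (rule finite_subset)
qed

text \<open>
  Along an infinite flow line the edge weights are eventually constant. From then on only the
  remainders \<open>t\<close> are used, and each step lifts to a sequence of prefix rewritings.
\<close>

lemma flow_terminates:
  "\<nexists>f :: nat \<Rightarrow> 'a \<times> 'a. \<forall>i. f i \<in> carrier G \<times> A - arcs nf_tree \<and> f (Suc i) \<in> set (flow (f i))"
proof
  assume "\<exists>f :: nat \<Rightarrow> 'a \<times> 'a. \<forall>i. f i \<in> carrier G \<times> A - arcs nf_tree \<and> f (Suc i) \<in> set (flow (f i))"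
  then obtain f :: "nat \<Rightarrow> 'a \<times> 'a" where
    f: "\<And>i. f i \<in> carrier G \<times> A - arcs nf_tree" "\<And>i. f (Suc i) \<in> set (flow (f i))" by blast
  define word where "word i = nf (fst (f i)) @ [snd (f i)]" for i
  have step: "edge_weight (f (Suc i)) < edge_weight (f i) \<or> edge_weight (f (Suc i)) \<le> edge_weight (f i) \<and>
    (\<exists>u b z. (word i, u @ b # z) \<in> R \<and> f (Suc i) = (val u, b))" for i
  proof -
    have "fst (f i) \<in> carrier G" "snd (f i) \<in> A" using f(1)[of i] by auto
    then show ?thesis
      using flow_non_tree_edge[of "nf (fst (f i))" "snd (f i)" "f (Suc i)"] f(1)[of i] f(1)[of "Suc i"] f(2)[of i]
      by (simp add: word_def)
  qed
  then have "edge_weight (f (Suc i)) \<le> edge_weight (f i)" for i by (meson less_imp_le)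
  then have anti: "edge_weight (f j) \<le> edge_weight (f i)" if "i \<le> j" for i j
    using lift_Suc_antimono_le[of "\<lambda>i. edge_weight (f i)"] that by blast
  let ?S = "edge_weight ` range f"
  have "?S \<subseteq> edge_weight ` {e \<in> carrier G \<times> A. edge_weight e \<le> edge_weight (f 0)}"
    using f(1) anti by blast
  then have fin: "finite ?S" using finite_edge_weights finite_subset by blast
  then have "Min ?S \<in> ?S" by (intro Min_in) auto
  then obtain n where n: "edge_weight (f n) = Min ?S" by auto
  have min: "edge_weight (f n) \<le> edge_weight (f i)" for i
    unfolding n using fin by (intro Min_le) auto
  \<comment> \<open>The lifted step applies the rule and then reduces the prefix \<open>u\<close> to
    \<open>nf (val u)\<close>; the letters after \<open>b\<close> stay behind as
    \<open>z\<close>.\<close>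
  have rewrite: "\<exists>z. z \<in> lists A \<and> (word i, word (Suc i) @ z) \<in> (prefix_step A R)\<^sup>+" if i: "n \<le> i" for i
  proof -
    have "\<not> edge_weight (f (Suc i)) < edge_weight (f i)"
      using anti[OF i] min[of "Suc i"] by simp
    then obtain u b z where u: "(word i, u @ b # z) \<in> R" "f (Suc i) = (val u, b)"
      using step[of i] by blast
    have l: "u \<in> lists A" "b # z \<in> lists A" "z \<in> lists A" using R_lists[OF u(1)] by auto
    have "(word i, u @ b # z) \<in> prefix_step A R"
      using u(1) by (force simp: prefix_step_def)
    moreover have "(u @ b # z, nf (val u) @ b # z) \<in> (prefix_step A R)\<^sup>*"
      using reduces_to_nf[OF l(1)] prefix_step_rtrancl_append l(2) by blast
    ultimately have "(word i, word (Suc i) @ z) \<in> (prefix_step A R)\<^sup>+"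
      by (simp add: word_def u(2))
    then show ?thesis using l(3) by blast
  qed
  \<comment> \<open>Each \<open>word i @ z\<close> would rewrite properly to another word of this
    form: the leftovers pile up at the right end, where they do not disturb prefix
    rewriting.\<close>
  have "\<forall>i z. n \<le> i \<longrightarrow> z \<in> lists A \<longrightarrow> W \<noteq> word i @ z" for W
  proof (induction W rule: wf_induct_rule[OF wf_trancl[OF wf_prefix_step]])
    case (1 W)
    show ?case
    proof (intro allI impI notI)
      fix i z assume i: "n \<le> i" "z \<in> lists A" "W = word i @ z"
      obtain z' where z': "z' \<in> lists A" "(word i, word (Suc i) @ z') \<in> (prefix_step A R)\<^sup>+"
        using rewrite[OF i(1)] by blast
      from z'(2) have "(word i @ z, (word (Suc i) @ z') @ z) \<in> (prefix_step A R)\<^sup>+"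
        by (induction rule: trancl_induct)
          (blast intro: trancl_into_trancl prefix_step_append[OF _ i(2)])+
      then have "(word (Suc i) @ z' @ z, W) \<in> ((prefix_step A R)\<inverse>)\<^sup>+"
        using i(3) by (simp add: trancl_converse)
      from 1[OF this, rule_format, of "Suc i" "z' @ z"] show False
        using i(1,2) z'(1) by simp
    qed
  qed
  from this[of "word n @ []", rule_format, of n "[]"] show False by simp
qed

text \<open>Labels have bounded length, so the language is a finite union over pairs of a letter
  \<open>a\<close> and a label \<open>p\<close>. For each pair the first component ranges over
  \<open>C a p\<close>, cut out of \<open>Irr\<close> by a condition on \<open>tails\<close> and the
  last \<open>k\<close> letters.\<close>

lemma sync_regular_flow:
  "sync_regular [A, A, A] {[tree_nf G nf_tree (fst e), [snd e], path_label (flow e)] | e. e \<in> carrier G \<times> A}"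
    (is "sync_regular _ ?L")
proof -
  let ?P = "{p. set p \<subseteq> A \<and> length p \<le> max_len}"
  define C where "C a p = {w \<in> Irr. flow_label w a = p}" for a p
  have L: "?L = (\<Union>(a, p)\<in>A \<times> ?P. (\<lambda>w. [w, [a], p]) ` C a p)"
  proof (intro equalityI subsetI)
    fix l assume "l \<in> ?L"
    then obtain g a where "g \<in> carrier G" "a \<in> A" "l = [nf g, [a], flow_label (nf g) a]"
      by (auto simp: tree_nf_nf_tree flow_def)
    moreover from this have "flow_label (nf g) a \<in> ?P"
      using flow_label_facts(1)[of "nf g" a] length_flow_label[of "nf g" a] by auto
    ultimately show "l \<in> (\<Union>(a, p)\<in>A \<times> ?P. (\<lambda>w. [w, [a], p]) ` C a p)"
      by (force simp: C_def)
  next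
    fix l assume "l \<in> (\<Union>(a, p)\<in>A \<times> ?P. (\<lambda>w. [w, [a], p]) ` C a p)"
    then obtain w a where w: "w \<in> Irr" "a \<in> A" "l = [w, [a], flow_label w a]"
      by (auto simp: C_def)
    then have "val w \<in> carrier G" using Irr_lists val_closed by blast
    then show "l \<in> ?L"
      using w by (intro CollectI exI[of _ "(val w, a)"]) (simp add: tree_nf_nf_tree flow_def nf_val)
  qed
  let ?\<Sigma> = "listset (map (\<lambda>A. insert None (Some ` A)) [A, A, A])"
  have C: "finite_quots A (C a p)" for a p
  proof -
    have "C a p = Irr \<inter> {w \<in> lists A.
        label_of a (tails (take (length w - k) w)) (drop (length w - k) w) = p}"
      using Irr_lists unfolding C_def flow_label_def by blast
    then show ?thesis
      using finite_quots_Int[OF finite_quots_Irr finite_quots_tails_suffix[of "\<lambda>X s. label_of a X s = p" k]]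
      by simp
  qed
  have "finite_quots ?\<Sigma> (\<Union>(a, p)\<in>A \<times> ?P. pad_tuple ` (\<lambda>w. [w, [a], p]) ` C a p)"
  proof (rule finite_quots_UN)
    show "finite (A \<times> ?P)"
      using finite_A finite_lists_length_le[OF finite_A] by (intro finite_cartesian_product)
    fix i assume "i \<in> A \<times> ?P"
    then obtain a p where "i = (a, p)" "a \<in> A" "p \<in> lists A" by auto
    then show "finite_quots ?\<Sigma> (case i of (a, p) \<Rightarrow> pad_tuple ` (\<lambda>w. [w, [a], p]) ` C a p)"
      using finite_quots_pad_tuple_letter_word[OF C _ _ finite_A] by (simp only: prod.case)
  qed
  moreover have "pad_tuple ` ?L = (\<Union>(a, p)\<in>A \<times> ?P. pad_tuple ` (\<lambda>w. [w, [a], p]) ` C a p)"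
    unfolding L by (simp only: image_UN split_def)
  moreover have "finite ?\<Sigma>"
  proof -
    have "?\<Sigma> \<subseteq> {l. set l \<subseteq> insert None (Some ` A) \<and> length l = 3}"
      by (auto simp: set_Cons_def)
    then show ?thesis
      using finite_lists_length_eq[of "insert None (Some ` A)" 3] finite_A finite_subset by fastforce
  qed
  moreover have "?L \<subseteq> listset (map lists [A, A, A])"
    unfolding L C_def using Irr_lists by (auto simp: set_Cons_def)
  ultimately show ?thesis
    unfolding sync_regular_def by (simp only: regular_language_if_finite_quots simp_thms)
qed

lemma regular_bounded_flow_flow: "regular_bounded_flow G A nf_tree flow"
proof -
  have label: "flow (g, a) = edge_path g (flow_label (nf g) a)" for g a
    by (simp add: flow_def)
  have sub: "set (edge_path g w) \<subseteq> carrier G \<times> A" if "g \<in> carrier G" "w \<in> lists A" for g w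
    using that by (induction w arbitrary: g) auto
  have "pre_digraph.awalk (cayley_graph G A) (fst e) (flow e) (head (cayley_graph G A) e)"
    if arc: "e \<in> carrier G \<times> A" for e
  proof -
    obtain g a where e: "e = (g, a)" "g \<in> carrier G" "a \<in> A" using arc by auto
    have "pre_digraph.awalk (cayley_graph G A) g (edge_path g (flow_label (nf g) a)) (g \<otimes> a)"
      using e flow_label_facts[of "nf g" a] sub
      by (subst awalk_iff_edge_path) auto
    then show ?thesis by (simp add: e label)
  qed
  moreover have "length (flow e) \<le> max_len" if "e \<in> carrier G \<times> A" for e
    using that length_flow_label by (auto simp: flow_def)
  moreover have "flow e = [e]" if "e \<in> arcs nf_tree" for e
  proof -
    obtain g a where e: "e = (g, a)" by fastforce
    then have "g \<in> carrier G" "a \<in> A" using that arcs_nf_tree_sub by auto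
    then show ?thesis using flow_label_tree[of "nf g" a] that e by (simp add: label)
  qed
  ultimately show ?thesis
    unfolding regular_bounded_flow_def Let_def cayley_graph_simps(2,3)
    using flow_terminates sync_regular_flow by (intro conjI ballI exI[of _ max_len]) blast+
qed

end

theorem theoremA:
  fixes G :: "('a, 'm) monoid_scheme" and A :: "'a set"
    and R :: "('a list \<times> 'a list) set" and wt :: "'a \<Rightarrow> real"
  assumes "group G"
    and "finite A" and "A \<subseteq> carrier G" and "generate G A = carrier G"
    and "\<forall>a\<in>A. inv\<^bsub>G\<^esub> a \<in> A"
    and "convergent_prs G A R"
    and "sync_regular_prs A R"
    and "\<forall>a\<in>A. wt a > 0"
    and "weight_nonincreasing wt R"
  shows "\<exists>T \<Phi>. cayley_spanning_tree G A T \<and> regular_bounded_flow G A T \<Phi> \<and>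
    {path_label p | p g. g \<in> carrier G \<and> tree_path G T g p} = irreducible_words A R"
proof -
  have "weighted_prs G A R wt"
    using assms by (simp add: weighted_prs_def weighted_prs_axioms_def)
  then interpret weighted_prs G A R wt .
  obtain wmin wmax K k where "weighted_prs_bounds G A R wt wmin wmax K k"
    using bounds_exist by blast
  then interpret weighted_prs_bounds G A R wt wmin wmax K k .
  show ?thesis
    using cayley_spanning_tree_nf_tree regular_bounded_flow_flow tree_path_labels by blast
qed

end
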